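(* Let $R$ be a commutative ring with identity. Let $G$ be a weighted cactoid digraph on $n$ vertices with blocks $G_1,\dots,G_r$, where $G_i$ is a weighted directed cycle on $n_i\ge2$ vertices $v^{(i)}_0,\dots,v^{(i)}_{n_i-1}$ (indices mod $n_i$) with arcs $(v^{(i)}_k,v^{(i)}_{k+1})$ of weight $w^{(i)}_k\in R$. Suppose each first weight $w_i=\sum_{k=0}^{n_i-1}w^{(i)}_k$ is invertible in $R$, and let $w_i^{(2)}=\sum_{0\le k<l\le n_i-1}w^{(i)}_kw^{(i)}_l$. Let $W_c$ be the distance matrix of $G$, i.e. $(W_c)_{uv}$ is the sum of the arc weights along the unique directed path from $u$ to $v$ in $G$ (and $0$ if $u=v$). For each $i$ define (natural bag) $\lambda_i=w_i^{(2)}/w_i$, vectors $\alpha_i,\beta_i$ indexed by $V(G_i)$ with $(\alpha_i)_{v^{(i)}_k}=w^{(i)}_{k-1}/w_i$ and $(\beta_i)_{v^{(i)}_k}=w^{(i)}_k/w_i$, and $L_i=\frac{1}{w_i}(I-P_i)$ where $P_i$ is the $V(G_i)\times V(G_i)$ matrix with nonzero entries $(P_i)_{v^{(i)}_k,v^{(i)}_{k+1}}=1$. Define $\lambda=\sum_{i=1}^r\lambda_i$, vectors $\alpha,\beta$ indexed by $V(G)$ by $\alpha_v=\sum_{i\in\mathrm{Bl}_G(v)}(\alpha_i)_v-\mathrm{bi}_G(v)+1$, $\beta_v=\sum_{i\in\mathrm{Bl}_G(v)}(\beta_i)_v-\mathrm{bi}_G(v)+1$, and $L=\sum_{i=1}^r\hat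 L_i$, where $(\hat L_i)_{uv}=(L_i)_{uv}$ if $u,v\in V(G_i)$ and $0$ otherwise. Then $\alpha^T\mathbf{j}=1$, $L\mathbf{j}=\mathbf{0}$, $\alpha^TW_c=\lambda\mathbf{j}^T$, $LW_c+I=\beta\mathbf{j}^T$, and $\mathbf{j}^T\beta=1$, $\mathbf{j}^TL=\mathbf{0}$, $W_c\beta=\lambda\mathbf{j}$, $W_cL+I=\mathbf{j}\alpha^T$; in particular $L$ is Laplacian-like. Furthermore, if $\lambda$ is invertible in $R$, then $W_c$ is invertible and $W_c^{-1}=-L+\lambda^{-1}\beta\alpha^T$.
   Context: A weighted cactoid digraph is a strongly connected directed graph each of whose blocks is a directed cycle (possibly of length two) whose arcs carry weights in $R$. A cut vertex is a vertex whose deletion disconnects the graph; a block is a strongly connected subgraph on at least two vertices with no cut vertex, maximal with this property. For $v\in V(G)$, $\mathrm{Bl}_G(v)$ is the set of indices $i$ with $v\in V(G_i)$ and $\mathrm{bi}_G(v)=|\mathrm{Bl}_G(v)|$. A square matrix $L$ is Laplacian-like if $L\mathbf{j}=\mathbf{0}$ and $\mathbf{j}^TL=\mathbf{0}$. $\mathbf{j}$ is an all-ones column vector, $I$ an identity matrix, $\mathbf{0}$ a zero matrix/vector, of appropriate sizes; $^T$ is transpose; $1/w_i$ is the inverse of $w_i$ in $R$. *)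

theory Defs
  imports "HOL-Analysis.Analysis" "Graph_Theory.Graph_Theory"
begin

section \<open>Cactoid digraphs\<close>

text \<open>
  A directed cycle has no cut vertex although deleting one of its vertices destroys strong
  connectedness, so ``disconnects'' refers to the underlying undirected graph; this is
  what \<^const>\<open>Digraph_Component.connected\<close> expresses. That constant is false for the empty
  graph, so the only vertex of a one-vertex graph has to be excluded separately.
\<close>

definition cut_vertex :: "('v, 'e) pre_digraph \<Rightarrow> 'v \<Rightarrow> bool" where
  "cut_vertex H x \<longleftrightarrow> x \<in> verts H \<and> verts (pre_digraph.del_vert H x) \<noteq> {} \<and>
     \<not> Digraph_Component.connected (pre_digraph.del_vert H x)"

definition blocks :: "('v, 'e) pre_digraph \<Rightarrow> ('v, 'e) pre_digraph set" where
  "blocks G = {H. pre_digraph.max_subgraph G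
     (\<lambda>H. strongly_connected H \<and> 2 \<le> card (verts H) \<and> (\<nexists>x. cut_vertex H x)) H}"

text \<open>\<open>H\<close> is the directed cycle on \<open>v 0, \<dots>, v (m - 1)\<close> with arcs \<open>e k\<close> from \<open>v k\<close> to \<open>v (k + 1)\<close>,
  indices modulo \<open>m\<close>.\<close>

definition cycle_labelling ::
    "('v, 'e) pre_digraph \<Rightarrow> nat \<Rightarrow> (nat \<Rightarrow> 'v) \<Rightarrow> (nat \<Rightarrow> 'e) \<Rightarrow> bool" where
  "cycle_labelling H m v e \<longleftrightarrow> 2 \<le> m \<and> inj_on v {..<m} \<and>
     verts H = v ` {..<m} \<and> arcs H = e ` {..<m} \<and>
     (\<forall>k<m. tail H (e k) = v k \<and> head H (e k) = v ((k + 1) mod m))"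

definition cactoid_digraph :: "('v, 'e) pre_digraph \<Rightarrow> bool" where
  "cactoid_digraph G \<longleftrightarrow> digraph G \<and> strongly_connected G \<and>
     (\<forall>H\<in>blocks G. \<exists>m v e. cycle_labelling H m v e)"

definition distance_matrix ::
    "('v::finite, 'e) pre_digraph \<Rightarrow> ('e \<Rightarrow> 'a::comm_ring_1) \<Rightarrow> 'a^'v^'v" where
  "distance_matrix G w = (\<chi> x y. if x = y then 0
     else sum_list (map w (THE p. pre_digraph.apath G x p y)))"


section \<open>The natural bag of a weighted directed cycle\<close>

text \<open>Below, \<open>x k\<close> is the weight of the arc leaving \<open>v k\<close>.\<close>

text \<open>The inverse of a unit; unspecified on non-units.\<close>

definition ring_inv :: "'a::comm_ring_1 \<Rightarrow> 'a" where
  "ring_inv a = (THE b. a * b = 1)"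

definition first_weight :: "nat \<Rightarrow> (nat \<Rightarrow> 'a::comm_ring_1) \<Rightarrow> 'a" where
  "first_weight m x = (\<Sum>k<m. x k)"

definition second_weight :: "nat \<Rightarrow> (nat \<Rightarrow> 'a::comm_ring_1) \<Rightarrow> 'a" where
  "second_weight m x = (\<Sum>l<m. \<Sum>k<l. x k * x l)"

definition cycle_lambda :: "nat \<Rightarrow> (nat \<Rightarrow> 'a::comm_ring_1) \<Rightarrow> 'a" where
  "cycle_lambda m x = second_weight m x * ring_inv (first_weight m x)"

text \<open>The following vectors and matrices are indexed by \<open>v ` {..<m}\<close> and are meaningful
  only there. The index \<open>k - 1\<close> modulo \<open>m\<close> is written \<open>(k + m - 1) mod m\<close>.\<close>

definition cycle_alpha :: "nat \<Rightarrow> (nat \<Rightarrow> 'v) \<Rightarrow> (nat \<Rightarrow> 'a::comm_ring_1) \<Rightarrow> 'v \<Rightarrow> 'a" where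
  "cycle_alpha m v x u =
     (let k = the_inv_into {..<m} v u in x ((k + m - 1) mod m) * ring_inv (first_weight m x))"

definition cycle_beta :: "nat \<Rightarrow> (nat \<Rightarrow> 'v) \<Rightarrow> (nat \<Rightarrow> 'a::comm_ring_1) \<Rightarrow> 'v \<Rightarrow> 'a" where
  "cycle_beta m v x u =
     (let k = the_inv_into {..<m} v u in x k * ring_inv (first_weight m x))"

definition cycle_perm :: "nat \<Rightarrow> (nat \<Rightarrow> 'v) \<Rightarrow> 'v \<Rightarrow> 'v \<Rightarrow> 'a::comm_ring_1" where
  "cycle_perm m v u u' = (if \<exists>k<m. u = v k \<and> u' = v ((k + 1) mod m) then 1 else 0)"

definition cycle_L ::
    "nat \<Rightarrow> (nat \<Rightarrow> 'v) \<Rightarrow> (nat \<Rightarrow> 'a::comm_ring_1) \<Rightarrow> 'v \<Rightarrow> 'v \<Rightarrow> 'a" where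
  "cycle_L m v x u u' =
     ring_inv (first_weight m x) * ((if u = u' then 1 else 0) - cycle_perm m v u u')"


section \<open>Gluing along blocks\<close>

text \<open>\<open>B 1, \<dots>, B r\<close> are the blocks.\<close>

definition Bl :: "nat \<Rightarrow> (nat \<Rightarrow> ('v, 'e) pre_digraph) \<Rightarrow> 'v \<Rightarrow> nat set" where
  "Bl r B u = {i \<in> {1..r}. u \<in> verts (B i)}"

definition bi :: "nat \<Rightarrow> (nat \<Rightarrow> ('v, 'e) pre_digraph) \<Rightarrow> 'v \<Rightarrow> nat" where
  "bi r B u = card (Bl r B u)"

definition glue_vec ::
    "nat \<Rightarrow> (nat \<Rightarrow> ('v::finite, 'e) pre_digraph) \<Rightarrow> (nat \<Rightarrow> 'v \<Rightarrow> 'a::comm_ring_1) \<Rightarrow> 'a^'v" where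
  "glue_vec r B f = (\<chi> u. (\<Sum>i\<in>Bl r B u. f i u) - of_nat (bi r B u) + 1)"

definition glue_mat ::
    "nat \<Rightarrow> (nat \<Rightarrow> ('v::finite, 'e) pre_digraph) \<Rightarrow> (nat \<Rightarrow> 'v \<Rightarrow> 'v \<Rightarrow> 'a::comm_ring_1) \<Rightarrow> 'a^'v^'v"
  where
  "glue_mat r B M = (\<Sum>i = 1..r.
     (\<chi> u u'. if u \<in> verts (B i) \<and> u' \<in> verts (B i) then M i u u' else 0))"


section \<open>Matrix notation\<close>

definition all_ones :: "'a::comm_ring_1^'n" where
  "all_ones = (\<chi> i. 1)"

text \<open>The rank-one matrix \<open>x y\<^sup>T\<close>.\<close>

definition outer_prod :: "'a::comm_ring_1^'m \<Rightarrow> 'a^'n \<Rightarrow> 'a^'n^'m" where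
  "outer_prod x y = (\<chi> i j. x $ i * y $ j)"

definition laplacian_like :: "'a::comm_ring_1^'n^'n \<Rightarrow> bool" where
  "laplacian_like L \<longleftrightarrow> L *v all_ones = 0 \<and> all_ones v* L = 0"

end

theory Submission
  imports Defs
begin

text \<open>
  Adding to a block a directed path between two of its vertices creates no cut vertex, so by
  maximality the path already lies in the block. In a cactoid digraph this makes the arc sets of
  the blocks a partition of the arcs and makes directed paths unique.

  Let \<open>d\<close> be the distance, and let \<open>a\<close> be the arc from \<open>u\<close> to \<open>u'\<close> of a block \<open>i\<close> containing \<open>u\<close>.
  If \<open>a\<close> is the first arc of the path from \<open>u\<close> to \<open>y\<close>, then \<open>d u y - d u' y\<close> is the weight of \<open>a\<close>;
  otherwise the path from \<open>u'\<close> to \<open>y\<close> returns to \<open>u\<close> around the cycle first, and the difference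
  is that weight minus the first weight of block \<open>i\<close>. Exactly one block at \<open>u \<noteq> y\<close> is in the first
  case, which gives \<open>L W + I = \<beta> j\<^sup>T\<close>; dually, last arcs give \<open>W L + I = j \<alpha>\<^sup>T\<close>. Seen from a vertex
  \<open>x\<close>, every block is entered through a single vertex, its gate, and summing over the blocks gives
  \<open>W \<beta> = \<lambda> j\<close>. The remaining identities follow by matrix algebra.
\<close>

section \<open>Paths and blocks\<close>

definition biconnected :: "('v, 'e) pre_digraph \<Rightarrow> bool" where
  "biconnected H \<longleftrightarrow> strongly_connected H \<and> 2 \<le> card (verts H) \<and> (\<nexists>x. cut_vertex H x)"

lemma blocks_conv: "blocks G = {H. pre_digraph.max_subgraph G biconnected H}"
  by (simp add: blocks_def biconnected_def[abs_def])

lemma strongly_connected_imp_connected: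
  assumes "wf_digraph H" "strongly_connected H" shows "Digraph_Component.connected H"
  using assms unfolding connected_def strongly_connected_def
  by (auto intro: wf_digraph.reachable_mk_symmetricI)

text \<open>\<open>cut_vertex\<close> concerns only vertices of \<open>H\<close> with a nonempty
  remainder. Having two vertices makes every remainder nonempty, and deleting a vertex outside
  \<open>H\<close> changes nothing, so \<open>t\<close> can be arbitrary.\<close>

lemma biconnected_connected_del_vert:
  assumes "wf_digraph H" "biconnected H"
  shows "Digraph_Component.connected (pre_digraph.del_vert H t)"
proof (cases "t \<in> verts H")
  case True
  have "verts H \<noteq> {t}" using assms by (auto simp: biconnected_def)
  then have "verts (pre_digraph.del_vert H t) \<noteq> {}" using True by (auto simp: pre_digraph.verts_del_vert)
  then show ?thesis using assms True by (auto simp: biconnected_def cut_vertex_def)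
next
  case False
  have "pre_digraph.del_vert H t = H"
    by (rule pre_digraph.equality)
      (use False assms(1) in \<open>auto simp: pre_digraph.del_vert_simps dest: wf_digraph.wellformed\<close>)
  then show ?thesis using assms strongly_connected_imp_connected by (auto simp: biconnected_def)
qed

lemma biconnectedI:
  assumes "strongly_connected H" "2 \<le> card (verts H)"
    and "\<And>t. Digraph_Component.connected (pre_digraph.del_vert H t)"
  shows "biconnected H"
  using assms by (auto simp: biconnected_def cut_vertex_def)

section \<open>Adding a directed path to a subgraph\<close>

definition (in pre_digraph) add_path :: "('a, 'b) pre_digraph \<Rightarrow> 'b list \<Rightarrow> ('a, 'b) pre_digraph" where
  "add_path H p = \<lparr>verts = verts H \<union> tail G ` set p \<union> head G ` set p,
     arcs = arcs H \<union> set p, tail = tail G, head = head G\<rparr>"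

lemma (in pre_digraph) add_path_simps [simp]:
  "verts (add_path H p) = verts H \<union> tail G ` set p \<union> head G ` set p"
  "arcs (add_path H p) = arcs H \<union> set p"
  "tail (add_path H p) = tail G" "head (add_path H p) = head G"
  by (simp_all add: add_path_def)

context wf_digraph
begin

lemma subgraph_add_path:
  assumes "subgraph H G" "set p \<subseteq> arcs G"
  shows "subgraph (add_path H p) G" "subgraph H (add_path H p)"
proof -
  have c: "tail H = tail G" "head H = head G" "wf_digraph H"
    using assms(1) by (auto simp: subgraph_def compatible_def)
  have wf: "wf_digraph (add_path H p)"
    by unfold_locales (use c wf_digraph.wellformed[OF c(3)] in auto)
  show "subgraph (add_path H p) G"
    by (rule subgraphI) (use wf wf_digraph assms in \<open>auto simp: compatible_def\<close>)
  show "subgraph H (add_path H p)"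
    by (rule subgraphI) (use wf c in \<open>auto simp: compatible_def\<close>)
qed

lemma awalk_subgraphI:
  assumes "awalk u p v" "subgraph H G" "set p \<subseteq> arcs H" "u \<in> verts H"
  shows "pre_digraph.awalk H u p v"
proof -
  have "compatible G H" using assms(2) by blast
  then show ?thesis
    using assms compatible_cas[of G H] by (auto simp: pre_digraph.awalk_def)
qed

lemma reachable_subgraphI:
  assumes "awalk u p v" "subgraph H G" "set p \<subseteq> arcs H" "u \<in> verts H"
  shows "u \<rightarrow>\<^sup>*\<^bsub>H\<^esub> v"
proof -
  interpret H: wf_digraph H using assms(2) by blast
  show ?thesis using awalk_subgraphI[OF assms] H.reachable_awalk by blast
qed

text \<open>The path leads from \<open>u\<close> to each of its vertices and from each of them to
  \<open>v\<close>; \<open>reach\<close> leads from \<open>v\<close> back to \<open>u\<close>. It is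
  weaker than strong connectedness of \<open>H\<close>, so that \<open>H\<close> may also be a
  single arc.\<close>

lemma strongly_connected_add_path:
  assumes H: "subgraph H G" and p: "awalk u p v" and uv: "u \<in> verts H" "v \<in> verts H"
    and reach: "\<And>z. z \<in> verts H \<Longrightarrow> v \<rightarrow>\<^sup>*\<^bsub>add_path H p\<^esub> z \<and> z \<rightarrow>\<^sup>*\<^bsub>add_path H p\<^esub> u"
  shows "strongly_connected (add_path H p)"
proof (rule strongly_connectedI)
  let ?D = "add_path H p"
  have pG: "set p \<subseteq> arcs G" using p by blast
  note sub = subgraph_add_path[OF H pG]
  interpret D: wf_digraph ?D using sub by blast
  show "verts ?D \<noteq> {}" using uv by auto
  have path: "u \<rightarrow>\<^sup>*\<^bsub>?D\<^esub> z \<and> z \<rightarrow>\<^sup>*\<^bsub>?D\<^esub> v" if "z \<in> set (awalk_verts u p)" for z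
  proof -
    from awalk_decomp[OF p that] obtain q r where
      *: "p = q @ r" "awalk u q z" "awalk z r v" by blast
    have "z \<in> verts ?D" using that set_awalk_verts[OF p] uv by auto
    then show ?thesis
      using reachable_subgraphI[OF *(2) sub(1)] reachable_subgraphI[OF *(3) sub(1)] uv *(1) by auto
  qed
  have vu: "v \<rightarrow>\<^sup>*\<^bsub>?D\<^esub> u" using reach uv by blast
  have all: "u \<rightarrow>\<^sup>*\<^bsub>?D\<^esub> z \<and> z \<rightarrow>\<^sup>*\<^bsub>?D\<^esub> u" if "z \<in> verts ?D" for z
  proof (cases "z \<in> verts H")
    case True
    have "u \<in> set (awalk_verts u p)" "v \<in> set (awalk_verts u p)"
      using p by (metis hd_in_awalk_verts(1), metis awalkE' awalk_verts_non_Nil last_in_set)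
    then show ?thesis using path reach True by (meson D.reachable_trans)
  next
    case False
    then have "z \<in> set (awalk_verts u p)" using that set_awalk_verts[OF p] by auto
    then show ?thesis using path vu by (meson D.reachable_trans)
  qed
  show "a \<rightarrow>\<^sup>*\<^bsub>?D\<^esub> b" if "a \<in> verts ?D" "b \<in> verts ?D" for a b
    using all that by (meson D.reachable_trans)
qed

text \<open>Deleting \<open>t\<close> breaks the simple path \<open>p\<close> in at most one place.
  A vertex left on \<open>p\<close> is thus still joined to \<open>u\<close> by the part before it
  or to \<open>v\<close> by the part after it, and the end so reached lies in the connected rest of
  \<open>H\<close>.\<close>

lemma connected_del_vert_add_path:
  assumes H: "subgraph H G" and p: "apath u p v" and uv: "u \<in> verts H" "v \<in> verts H"
    and conn: "Digraph_Component.connected (pre_digraph.del_vert H t)" and "u \<noteq> v"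
  shows "Digraph_Component.connected (pre_digraph.del_vert (add_path H p) t)"
proof -
  let ?D = "pre_digraph.del_vert (add_path H p) t" and ?K = "pre_digraph.del_vert H t"
  let ?M = "mk_symmetric ?D"
  have w: "awalk u p v" using p by (simp add: apath_def)
  then have pG: "set p \<subseteq> arcs G" by blast
  note sub = subgraph_add_path[OF H pG]
  have wf: "wf_digraph (add_path H p)" "wf_digraph H" using sub by auto
  have c: "tail H = tail G" "head H = head G"
    using assms(1) by (auto simp: subgraph_def compatible_def)
  have DA: "subgraph ?D (add_path H p)" by (rule wf_digraph.subgraph_del_vert[OF wf(1)])
  then have DG: "subgraph ?D G" using sub(1) subgraph_trans by blast
  interpret D: wf_digraph ?D using DA by blast
  interpret K: wf_digraph ?K using wf_digraph.subgraph_del_vert[OF wf(2)] by blast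
  have KD: "subgraph ?K ?D"
    by (rule subgraphI)
      (use c D.wf_digraph K.wf_digraph in \<open>auto simp: compatible_def pre_digraph.del_vert_simps\<close>)
  interpret M: pair_wf_digraph ?M by (rule D.wellformed_mk_symmetric)
  have K: "a \<rightarrow>\<^sup>*\<^bsub>?M\<^esub> b" if "a \<in> verts ?K" "b \<in> verts ?K" for a b
  proof -
    have "a \<rightarrow>\<^sup>*\<^bsub>mk_symmetric ?K\<^esub> b"
      using conn that by (auto simp: connected_def strongly_connected_def)
    then show ?thesis by (rule pre_digraph.reachable_mono[OF _ subgraph_mk_symmetric[OF KD]])
  qed
  have seg: "a \<rightarrow>\<^sup>*\<^bsub>?M\<^esub> b"
    if "awalk a q b" "set q \<subseteq> set p" "t \<notin> set (awalk_verts a q)" "a \<in> verts (add_path H p)" for a b q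
  proof -
    have "set q \<subseteq> arcs ?D"
      using that awalk_verts_arc1 awalk_verts_arc2[OF that(1)]
      by (auto simp: pre_digraph.del_vert_simps)
    moreover have "a \<in> verts ?D"
      using that hd_in_awalk_verts(1)[OF that(1)] by (auto simp: pre_digraph.del_vert_simps)
    ultimately show ?thesis
      using reachable_subgraphI[OF that(1) DG] D.reachable_mk_symmetricI by blast
  qed
  have sym: "b \<rightarrow>\<^sup>*\<^bsub>?M\<^esub> a" if "a \<rightarrow>\<^sup>*\<^bsub>?M\<^esub> b" for a b
    using symmetric_reachable[OF symmetric_mk_symmetric that] .
  have ex: "\<exists>b\<in>verts ?K. z \<rightarrow>\<^sup>*\<^bsub>?M\<^esub> b" if z: "z \<in> verts ?D" for z
  proof (cases "z \<in> verts H")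
    case True
    then show ?thesis using z K by (auto simp: pre_digraph.del_vert_simps intro!: bexI[of _ z])
  next
    case False
    then have zp: "z \<in> set (awalk_verts u p)" and zA: "z \<in> verts (add_path H p)" and "z \<noteq> t"
      using z set_awalk_verts[OF w] by (auto simp: pre_digraph.del_vert_simps)
    from awalk_decomp[OF w zp] obtain q r where
      *: "p = q @ r" "awalk u q z" "awalk z r v" by blast
    show ?thesis
    proof (cases "t \<in> set (awalk_verts u q)")
      case False
      have "u \<rightarrow>\<^sup>*\<^bsub>?M\<^esub> z" using seg[OF *(2) _ False] *(1) uv by auto
      moreover have "u \<in> verts ?K"
        using uv False hd_in_awalk_verts(1)[OF *(2)] by (auto simp: pre_digraph.del_vert_simps)
      ultimately show ?thesis using sym by blast
    next
      case True
      \<comment> \<open>A simple path that visits \<open>t\<close> before \<open>z\<close> does not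
        visit \<open>t\<close> after \<open>z\<close>.\<close>
      have tl: "t \<notin> set (tl (awalk_verts z r))"
        using apath_decomp_disjoint[OF p *(1) True] *(2) by auto
      moreover have "awalk_verts z r = z # tl (awalk_verts z r)"
        using *(3) by (metis awhd_of_awalk awalk_verts_non_Nil list.collapse)
      ultimately have F: "t \<notin> set (awalk_verts z r)" using \<open>z \<noteq> t\<close>
        by (metis set_ConsD)
      have "z \<rightarrow>\<^sup>*\<^bsub>?M\<^esub> v" using seg[OF *(3) _ F zA] *(1) by auto
      moreover have "v \<in> set (awalk_verts z r)"
        using *(3) by (metis awalkE' awalk_verts_non_Nil last_in_set)
      then have "v \<in> verts ?K" using uv F by (auto simp: pre_digraph.del_vert_simps)
      ultimately show ?thesis by blast
    qed
  qed
  have "a \<rightarrow>\<^sup>*\<^bsub>?M\<^esub> b" if "a \<in> verts ?D" "b \<in> verts ?D" for a b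
    using ex[OF that(1)] ex[OF that(2)] K sym by (meson M.reachable_trans)
  moreover have "verts ?D \<noteq> {}"
    using \<open>u \<noteq> v\<close> uv by (cases "t = u") (auto simp: pre_digraph.del_vert_simps)
  ultimately show ?thesis by (auto simp: connected_def strongly_connected_def)
qed

end

text \<open>\<open>add_path H p\<close> is again biconnected, so the maximality of \<open>H\<close>
  forces it to equal \<open>H\<close>.\<close>

lemma (in digraph) apath_subset_block:
  assumes H: "H \<in> blocks G" and uv: "u \<in> verts H" "v \<in> verts H" "u \<noteq> v" and p: "apath u p v"
  shows "set p \<subseteq> arcs H"
proof -
  let ?D = "add_path H p"
  have sub: "subgraph H G" and bi: "biconnected H"
    using H by (auto simp: blocks_conv max_subgraph_def)
  have w: "awalk u p v" using p by (simp add: apath_def)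
  then have pG: "set p \<subseteq> arcs G" by blast
  note subD = subgraph_add_path[OF sub pG]
  interpret H: wf_digraph H using sub by blast
  have "strongly_connected ?D"
  proof (rule strongly_connected_add_path[OF sub w uv(1,2)])
    fix z assume "z \<in> verts H"
    then have "v \<rightarrow>\<^sup>*\<^bsub>H\<^esub> z" "z \<rightarrow>\<^sup>*\<^bsub>H\<^esub> u"
      using bi uv by (auto simp: biconnected_def strongly_connected_def)
    then show "v \<rightarrow>\<^sup>*\<^bsub>?D\<^esub> z \<and> z \<rightarrow>\<^sup>*\<^bsub>?D\<^esub> u"
      using pre_digraph.reachable_mono[OF _ subD(2)] by blast
  qed
  moreover have "2 \<le> card (verts ?D)"
  proof -
    have "card (verts H) \<le> card (verts ?D)"
      using fin_digraph.finite_verts[OF fin_digraph_subgraph[OF subD(1)]]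
        subgraph_imp_subverts[OF subD(2)] by (rule card_mono)
    then show ?thesis using bi by (simp add: biconnected_def)
  qed
  moreover have "Digraph_Component.connected (pre_digraph.del_vert ?D t)" for t
    using connected_del_vert_add_path[OF sub p uv(1,2) _ uv(3)]
      biconnected_connected_del_vert[OF H.wf_digraph bi] by blast
  ultimately have "biconnected ?D" by (rule biconnectedI)
  then have "?D = H" using H subD by (auto simp: blocks_conv max_subgraph_def)
  then show ?thesis by (metis add_path_simps(2) Un_upper2)
qed

text \<open>By finiteness some biconnected subgraph above \<open>D\<close> has the greatest number
  of vertices and arcs together. A biconnected enlargement of it has the same vertices and arcs, so
  it is maximal.\<close>

lemma (in digraph) biconnected_subset_block:
  assumes D: "subgraph D G" "biconnected D"
  shows "\<exists>H\<in>blocks G. subgraph D H"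
proof -
  let ?P = "\<lambda>H. subgraph D H \<and> subgraph H G \<and> biconnected H"
  let ?f = "\<lambda>H. card (verts H) + card (arcs H)"
  have fin: "finite (verts H)" "finite (arcs H)" if "subgraph H G" for H
    using that by (auto simp: subgraph_def intro: finite_subset)
  have "\<forall>H. ?P H \<longrightarrow> ?f H < Suc (card (verts G) + card (arcs G))"
    unfolding less_Suc_eq_le by (intro allI impI add_mono card_mono) (auto simp: subgraph_def)
  moreover have "?P D" using D wf_digraph.subgraph_refl[of D] by (auto simp: subgraph_def)
  ultimately have "\<exists>H. ?P H \<and> (\<forall>H'. ?P H' \<longrightarrow> ?f H' \<le> ?f H)"
    by (rule ex_has_greatest_nat[rotated])
  then obtain H where *: "?P H \<and> (\<forall>H'. ?P H' \<longrightarrow> ?f H' \<le> ?f H)" ..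
  then have H: "?P H" by (rule conjunct1)
  have max: "?f H' \<le> ?f H" if "?P H'" for H' using that by (rule mp[OF spec[OF conjunct2[OF *]]])
  have "\<not> biconnected H'" if H': "H' \<noteq> H" "subgraph H H'" "subgraph H' G" for H'
  proof
    assume "biconnected H'"
    then have le: "?f H' \<le> ?f H" using H H' max subgraph_trans by blast
    have ss: "verts H \<subseteq> verts H'" "arcs H \<subseteq> arcs H'" using H'(2) by auto
    have c: "card (verts H) \<le> card (verts H')" "card (arcs H) \<le> card (arcs H')"
      using ss fin[OF H'(3)] by (auto intro: card_mono)
    then have "verts H = verts H'" "arcs H = arcs H'"
      using le ss fin[OF H'(3)] by (simp_all add: card_subset_eq)
    then have "H' = H"
      using H'(2) by (intro pre_digraph.equality) (auto simp: subgraph_def compatible_def)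
    then show False using H' by simp
  qed
  then have "max_subgraph biconnected H" using H by (auto simp: max_subgraph_def)
  then show ?thesis using H by (auto simp: blocks_conv)
qed

text \<open>A simple path from the head of \<open>a\<close> back to its tail closes \<open>a\<close>
  to a directed cycle. This cycle is biconnected and hence lies in a block.\<close>

lemma (in digraph) arc_in_block:
  assumes sc: "strongly_connected G" and a: "a \<in> arcs G"
  shows "\<exists>H\<in>blocks G. a \<in> arcs H"
proof -
  let ?x = "tail G a" and ?y = "head G a"
  let ?H = "\<lparr>verts = {?x, ?y}, arcs = {a}, tail = tail G, head = head G\<rparr>"
  have "?y \<rightarrow>\<^sup>* ?x" using sc a by (auto simp: strongly_connected_def)
  then obtain p where p: "apath ?y p ?x" using reachable_apath by blast
  let ?D = "add_path ?H p"
  have xy: "?x \<noteq> ?y" using a no_loops by blast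
  interpret H: wf_digraph ?H by unfold_locales auto
  have sub: "subgraph ?H G"
    by (rule subgraphI) (use a H.wf_digraph wf_digraph in \<open>auto simp: compatible_def\<close>)
  have w: "awalk ?y p ?x" using p by (simp add: apath_def)
  then have pG: "set p \<subseteq> arcs G" by blast
  note subD = subgraph_add_path[OF sub pG]
  interpret D: wf_digraph ?D using subD by blast
  have "strongly_connected ?D"
  proof (rule strongly_connected_add_path[OF sub w])
    have "?x \<rightarrow>\<^bsub>?D\<^esub> ?y" by (rule D.dominatesI[of a]) (auto simp: arc_to_ends_def)
    then have "?x \<rightarrow>\<^sup>*\<^bsub>?D\<^esub> ?y" by (rule D.reachable_adjI)
    then show "?x \<rightarrow>\<^sup>*\<^bsub>?D\<^esub> z \<and> z \<rightarrow>\<^sup>*\<^bsub>?D\<^esub> ?y" if "z \<in> verts ?H" for z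
      using that by auto
  qed auto
  moreover have "2 \<le> card (verts ?D)"
  proof -
    have "card {?x, ?y} \<le> card (verts ?D)" by (intro card_mono) auto
    then show ?thesis using xy by simp
  qed
  \<comment> \<open>It is enough to treat the single arc \<open>?H\<close>: deleting
    \<open>t\<close> leaves the arc or one of its ends, which is connected.\<close>
  moreover have "Digraph_Component.connected (pre_digraph.del_vert ?D t)" for t
  proof (rule connected_del_vert_add_path[OF sub p _ _ _ xy[symmetric]])
    let ?K = "pre_digraph.del_vert ?H t"
    interpret K: wf_digraph ?K by (rule H.wf_digraph_del_vert)
    interpret M: pair_wf_digraph "mk_symmetric ?K" by (rule K.wellformed_mk_symmetric)
    have "u \<rightarrow>\<^sup>*\<^bsub>mk_symmetric ?K\<^esub> v" if uv: "u \<in> verts ?K" "v \<in> verts ?K" for u v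
    proof (cases "u = v")
      case True
      then show ?thesis using K.reachable_mk_symmetricI[OF K.reachable_refl[OF uv(1)]] by simp
    next
      case False
      then have "a \<in> arcs ?K" "(u, v) = (?x, ?y) \<or> (u, v) = (?y, ?x)"
        using uv by (auto simp: pre_digraph.del_vert_simps)
      then have "(u, v) \<in> parcs (mk_symmetric ?K)"
        by (auto simp: parcs_mk_symmetric pre_digraph.del_vert_simps)
      then show ?thesis by (intro M.reachable_adjI) simp
    qed
    moreover have "verts ?K \<noteq> {}"
      using xy by (cases "t = ?x") (auto simp: pre_digraph.del_vert_simps)
    ultimately show "Digraph_Component.connected ?K"
      by (auto simp: connected_def strongly_connected_def)
  qed auto
  ultimately have "biconnected ?D" by (rule biconnectedI)
  then obtain K where K: "K \<in> blocks G" "subgraph ?D K"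
    using biconnected_subset_block[OF subD(1)] by blast
  have "a \<in> arcs ?D" by simp
  then show ?thesis using K unfolding subgraph_def by blast
qed

section \<open>Paths along a directed cycle\<close>

definition cycle_path :: "(nat \<Rightarrow> 'e) \<Rightarrow> nat \<Rightarrow> nat \<Rightarrow> nat \<Rightarrow> 'e list" where
  "cycle_path e m j l = map (\<lambda>t. e ((j + t) mod m)) [0..<l]"

context wf_digraph
begin

context
  fixes H :: "('a, 'b) pre_digraph" and m v e
  assumes sub: "subgraph H G" and cyc: "cycle_labelling H m v e"
begin

lemma cycle_labelling_arc:
  assumes "k < m"
  shows "e k \<in> arcs G" "tail G (e k) = v k" "head G (e k) = v (Suc k mod m)"
  using assms sub cyc by (auto simp: cycle_labelling_def subgraph_def compatible_def)

lemma cycle_labelling_vert: "k < m \<Longrightarrow> v k \<in> verts G"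
  using sub cyc by (auto simp: cycle_labelling_def subgraph_def)

text \<open>Induction on the length, appending one arc; \<open>l\<close> may exceed a full turn. The
  visited vertices are listed because simplicity is read off from them.\<close>

lemma cycle_path_awalk:
  "awalk (v (j mod m)) (cycle_path e m j l) (v ((j + l) mod m)) \<and>
   awalk_verts (v (j mod m)) (cycle_path e m j l) = map (\<lambda>t. v ((j + t) mod m)) [0..<Suc l]"
proof (induction l)
  case 0
  have "0 < m" using cyc by (simp add: cycle_labelling_def)
  then show ?case by (simp add: cycle_path_def awalk_Nil_iff cycle_labelling_vert)
next
  case (Suc l)
  let ?a = "e ((j + l) mod m)"
  have m: "(j + l) mod m < m" using cyc by (simp add: cycle_labelling_def)
  have eq: "cycle_path e m j (Suc l) = cycle_path e m j l @ [?a]" by (simp add: cycle_path_def)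
  have a: "awalk (v ((j + l) mod m)) [?a] (v ((j + Suc l) mod m))"
    using cycle_labelling_arc[OF m] cycle_labelling_vert[of "(j + Suc l) mod m"] m
    by (auto simp: awalk_simps mod_Suc_eq)
  then have w: "awalk (v (j mod m)) (cycle_path e m j l @ [?a]) (v ((j + Suc l) mod m))"
    using Suc by (blast intro: awalk_appendI)
  then show ?case
    unfolding eq using Suc cycle_labelling_arc[OF m] awalk_verts_append[OF w]
    by (simp add: mod_Suc_eq)
qed

text \<open>Fewer than \<open>m\<close> steps visit at most \<open>m\<close> consecutive labels,
  which are distinct modulo \<open>m\<close>.\<close>

lemma cycle_path_apath:
  assumes "j < m" "l < m"
  shows "apath (v j) (cycle_path e m j l) (v ((j + l) mod m))"
proof -
  have "distinct (map (\<lambda>t. v ((j + t) mod m)) [0..<Suc l])"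
    unfolding distinct_map
  proof (intro conjI inj_onI)
    fix s t assume st: "s \<in> set [0..<Suc l]" "t \<in> set [0..<Suc l]"
      and eq: "v ((j + s) mod m) = v ((j + t) mod m)"
    have "(j + s) mod m = (j + t) mod m"
      using eq cyc assms inj_onD[of v "{..<m}"] by (simp add: cycle_labelling_def)
    moreover have mod: "(j + x) mod m = (if j + x < m then j + x else j + x - m)" if "x < m" for x
      using that assms by (simp add: mod_if)
    moreover have "s < m" "t < m" using st assms by auto
    ultimately show "s = t" by (simp add: mod split: if_splits)
  qed simp
  then show ?thesis using cycle_path_awalk[of j l] assms by (simp add: apath_def)
qed

lemma cycle_path_apath_between:
  assumes "j < m" "k < m"
  obtains l where "l < m" "k = (j + l) mod m" "apath (v j) (cycle_path e m j l) (v k)"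
proof -
  \<comment> \<open>The number of steps forward from \<open>j\<close> to \<open>k\<close>; adding
    \<open>m\<close> first keeps the subtraction on natural numbers from truncating.\<close>
  let ?l = "(k + m - j) mod m"
  have "(j + ?l) mod m = (j + (k + m - j)) mod m" by (rule mod_add_right_eq)
  also have "\<dots> = k" using assms by simp
  finally show ?thesis using that[of ?l] cycle_path_apath[of j ?l] assms by simp
qed

end

end

section \<open>Arc-disjointness of blocks and uniqueness of paths\<close>

locale cactoid = digraph G for G :: "('v, 'e) pre_digraph" (structure) +
  assumes sc: "strongly_connected G"
    and block_cycle: "H \<in> blocks G \<Longrightarrow> \<exists>m v e. cycle_labelling H m v e"
begin

lemma block_subgraph: "H \<in> blocks G \<Longrightarrow> subgraph H G"
  by (simp add: blocks_conv max_subgraph_def)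

text \<open>The common arc puts two neighbouring vertices of the cycle \<open>H'\<close> into
  \<open>H\<close>. The rest of \<open>H'\<close> is a path between them and so lies in
  \<open>H\<close> as well; maximality then turns the inclusion of \<open>H'\<close> in
  \<open>H\<close> into equality.\<close>

lemma block_arc_unique:
  assumes H: "H \<in> blocks G" "H' \<in> blocks G" and a: "a \<in> arcs H" "a \<in> arcs H'"
  shows "H = H'"
proof -
  obtain m v e where cyc: "cycle_labelling H' m v e" using block_cycle H by blast
  note sub = block_subgraph[OF H(1)] block_subgraph[OF H(2)]
  note arc = cycle_labelling_arc[OF sub(2) cyc]
  have m: "2 \<le> m" and vs: "verts H' = v ` {..<m}" "arcs H' = e ` {..<m}"
    using cyc by (auto simp: cycle_labelling_def)
  obtain k where k: "k < m" "a = e k" using a vs by auto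
  \<comment> \<open>\<open>?p\<close> runs through all arcs of \<open>H'\<close> other than
    \<open>e k\<close>, from the head of \<open>a\<close> back to its tail.\<close>
  let ?j = "Suc k mod m" and ?p = "cycle_path e m (Suc k mod m) (m - 1)"
  have "(?j + (m - 1)) mod m = (Suc k + (m - 1)) mod m" by (rule mod_add_left_eq)
  also have "\<dots> = k" using k m by simp
  finally have p: "apath (v ?j) ?p (v k)"
    using cycle_path_apath[OF sub(2) cyc, of ?j "m - 1"] m by simp
  have "v k \<in> verts H" "v ?j \<in> verts H"
    using a(1) sub(1) arc[OF k(1)] k(2) wf_digraph.wellformed[of H a]
    by (auto simp: subgraph_def compatible_def)
  moreover have "v ?j \<noteq> v k" using arc[OF k(1)] no_loops by metis
  ultimately have pH: "set ?p \<subseteq> arcs H" using apath_subset_block[OF H(1)] p by blast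
  have "e i \<in> arcs H" if i: "i < m" for i
  proof (cases "i = k")
    case False
    \<comment> \<open>The position of \<open>e i\<close> in \<open>?p\<close>, counted from label
      \<open>Suc k\<close>. Position \<open>m - 1\<close> would be label \<open>k\<close>, so
      \<open>?t\<close> is below the length \<open>m - 1\<close> of \<open>?p\<close>.\<close>
    let ?t = "(i + m - Suc k) mod m"
    have "(?j + ?t) mod m = (Suc k + (i + m - Suc k)) mod m" by (simp add: mod_simps)
    also have "\<dots> = i" using i k by simp
    finally have t: "(?j + ?t) mod m = i" .
    have "?t < m - 1"
    proof (rule ccontr)
      assume "\<not> ?t < m - 1"
      then have "?t = m - 1" using m mod_less_divisor[of m "i + m - Suc k"] by linarith
      then show False using t \<open>(?j + (m - 1)) mod m = (Suc k + (m - 1)) mod m\<close> k m False by simp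
    qed
    then have "e i \<in> set ?p" unfolding cycle_path_def using t by (auto intro!: image_eqI[of _ _ ?t])
    then show ?thesis using pH by blast
  qed (use k a in simp)
  then have A: "arcs H' \<subseteq> arcs H" using vs by auto
  have "v i \<in> verts H" if "i < m" for i
    using arc[OF that] A vs that sub(1) wf_digraph.wellformed[of H "e i"]
    by (auto simp: subgraph_def compatible_def)
  then have "verts H' \<subseteq> verts H" using vs by auto
  then have "subgraph H' H" using A sub by (auto simp: subgraph_def compatible_def)
  then show ?thesis using H max_subgraph_subg_eq by (auto simp: blocks_conv)
qed

lemma block_out_arc_unique:
  assumes "H \<in> blocks G" "a \<in> arcs H" "b \<in> arcs H" "tail G a = tail G b"
  shows "a = b"
proof -
  obtain m v e where cyc: "cycle_labelling H m v e" using block_cycle assms by blast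
  have inj: "inj_on v {..<m}" and "arcs H = e ` {..<m}"
    using cyc by (auto simp: cycle_labelling_def)
  then obtain k l where kl: "k < m" "a = e k" "l < m" "b = e l" using assms by auto
  then have "v k = v l"
    using cycle_labelling_arc(2)[OF block_subgraph[OF assms(1)] cyc] assms(4) by metis
  then show ?thesis using inj kl by (auto dest: inj_onD)
qed

text \<open>Follow the path to \<open>y\<close> and return towards \<open>x\<close>, stopping at the tail of \<open>c\<close>: this
  joins two vertices of \<open>K\<close> by a path that starts with \<open>a\<close>.\<close>

lemma apath_first_arc_in_block:
  assumes p: "apath x (a # p) y" and r: "apath y (r @ [c]) x"
    and K: "K \<in> blocks G" "c \<in> arcs K"
  shows "a \<in> arcs K"
proof -
  let ?s = "tail G c"
  have w: "awalk (head G a) p y" and a: "a \<in> arcs G" "tail G a = x"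
    and xp: "x \<notin> set (awalk_verts (head G a) p)"
    using p by (auto simp: apath_Cons_iff awalk_Cons_iff apath_def)
  have wr: "awalk y r ?s" and c: "c \<in> arcs G" "head G c = x"
    using r by (auto simp: apath_def awalk_simps)
  have xr: "x \<notin> set (awalk_verts y r)"
    using apath_decomp_disjoint[OF r refl, of x] c wr by auto
  have wpr: "awalk (head G a) (p @ r) ?s" using w wr by (rule awalk_appendI)
  \<comment> \<open>The combined walk may repeat vertices. Shortening it only drops arcs, so the
    result still avoids \<open>x\<close>, and \<open>a\<close> can be put in front of it.\<close>
  let ?q = "awalk_to_apath (p @ r)"
  have q: "apath (head G a) ?q ?s" "set ?q \<subseteq> set (p @ r)"
    using apath_awalk_to_apath[OF wpr] awalk_to_apath_subset[OF wpr] by auto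
  have wq: "awalk (head G a) ?q ?s" using q by (simp add: apath_def)
  have "x \<notin> set (awalk_verts (head G a) (p @ r))"
    using xp xr set_awalk_verts_append[OF w wr] by auto
  moreover have "set (awalk_verts (head G a) ?q) \<subseteq> set (awalk_verts (head G a) (p @ r))"
    unfolding set_awalk_verts[OF wq] set_awalk_verts[OF wpr] set_map
    using q(2) by (intro Un_mono image_mono subset_refl)
  ultimately have "x \<notin> set (awalk_verts (head G a) ?q)" by blast
  then have "apath x (a # ?q) ?s" using q a by (simp add: apath_Cons_iff)
  moreover have "x \<in> verts K" "?s \<in> verts K"
    using K c block_subgraph[OF K(1)] wf_digraph.wellformed[of K c]
    by (auto simp: subgraph_def compatible_def)
  moreover have "x \<noteq> ?s" using c no_loops by metis
  ultimately show ?thesis using apath_subset_block[OF K(1), of x ?s "a # ?q"] by auto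
qed

text \<open>Take the block of the last arc \<open>c\<close> of a return path from \<open>y\<close>
  to \<open>x\<close>. The first arc of every simple path from \<open>x\<close> to \<open>y\<close>
  lies in this block, which has only one arc leaving \<open>x\<close>; induction handles the rest of
  the path.\<close>

lemma apath_unique:
  assumes "apath x p y" "apath x q y"
  shows "p = q"
  using assms
proof (induction p arbitrary: x q)
  case Nil
  then show ?case using apath_nonempty_ends[of x q y] by (auto simp: apath_Nil_iff)
next
  case (Cons a p)
  have xy: "x \<noteq> y" using apath_nonempty_ends[OF Cons.prems(1)] by simp
  then obtain b q' where q: "q = b # q'"
    using Cons.prems(2) by (cases q) (auto simp: apath_Nil_iff)
  have "y \<rightarrow>\<^sup>* x" using sc Cons.prems(1)
    by (auto simp: strongly_connected_def apath_def elim!: awalkE')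
  then obtain r where r: "apath y r x" using reachable_apath by blast
  then have "r \<noteq> []" using xy by (auto simp: apath_Nil_iff)
  then obtain r' c where rc: "r = r' @ [c]" by (metis rev_exhaust)
  then have "c \<in> arcs G" using r by (auto simp: apath_def awalk_simps)
  then obtain K where K: "K \<in> blocks G" "c \<in> arcs K" using arc_in_block[OF sc] by blast
  have "a \<in> arcs K" "b \<in> arcs K"
    using apath_first_arc_in_block[OF _ _ K] Cons.prems r rc q by blast+
  moreover have "tail G a = tail G b" using Cons.prems q by (auto simp: apath_Cons_iff)
  ultimately have "a = b" using block_out_arc_unique K by blast
  then show ?case using Cons q by (auto simp: apath_Cons_iff)
qed

end

section \<open>Algebra of bags\<close>

text \<open>A unit has only one inverse, so the definite description in \<open>ring_inv\<close> is
  well-defined.\<close>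

lemma ring_inv_right:
  fixes a :: "'a::comm_ring_1"
  assumes "a dvd 1" shows "a * ring_inv a = 1"
proof -
  obtain b where b: "a * b = 1" using assms by (metis dvdE)
  have "c = b" if "a * c = 1" for c
    using b that by (metis mult.assoc mult.commute mult_1)
  then show ?thesis unfolding ring_inv_def using theI[of "\<lambda>c. a * c = 1" b] b by blast
qed

text \<open>For a shift by one, the end values \<open>?g 0\<close> and \<open>?g m\<close> agree, so
  dropping either of them leaves the same sum.\<close>

lemma sum_cyclic_shift:
  fixes f :: "nat \<Rightarrow> 'a::ab_group_add"
  shows "(\<Sum>t<m. f ((k + t) mod m)) = (\<Sum>t<m. f t)"
proof (induction k)
  case (Suc k)
  let ?g = "\<lambda>t. f ((k + t) mod m)"
  have "?g 0 + (\<Sum>t<m. ?g (Suc t)) = (\<Sum>t<m. ?g t) + ?g m"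
    by (rule trans[OF sum.lessThan_Suc_shift[symmetric] sum.lessThan_Suc])
  then show ?case using Suc by simp
qed simp

text \<open>The two end terms of the extended list are equal and the remaining sums agree, so
  dropping either end removes the same products. Hence the labelling of a cycle may be restarted at
  any vertex when \<open>cycle_lambda\<close> is computed.\<close>

lemma second_weight_cyclic_shift:
  "second_weight m (\<lambda>t. f ((k + t) mod m)) = second_weight m f"
proof (induction k)
  case 0
  show ?case unfolding second_weight_def by (intro sum.cong) auto
next
  case (Suc k)
  let ?g = "\<lambda>t. f ((k + t) mod m)"
  have gm: "?g m = ?g 0" by simp
  \<comment> \<open>split off the last, respectively the first, term of the list \<open>?g 0, \<dots>, ?g m\<close>\<close>
  have "second_weight (Suc m) ?g = second_weight m ?g + (\<Sum>t<m. ?g t) * ?g m"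
    by (simp add: second_weight_def sum_distrib_right)
  moreover have "second_weight (Suc m) ?g = second_weight m (\<lambda>t. ?g (Suc t)) + ?g 0 * (\<Sum>t<m. ?g (Suc t))"
    unfolding second_weight_def sum.lessThan_Suc_shift
    by (simp add: sum.distrib sum_distrib_left del: sum.lessThan_Suc)
  moreover have "(\<Sum>t<m. ?g (Suc t)) = (\<Sum>t<m. ?g t)"
    using sum_cyclic_shift[of f "Suc k" m] sum_cyclic_shift[of f k m] by simp
  ultimately have "second_weight m (\<lambda>t. ?g (Suc t)) = second_weight m ?g"
    using gm by (simp add: algebra_simps)
  then show ?case using Suc by simp
qed

section \<open>Matrix identities over a commutative ring\<close>

lemma matrix_matrix_mult_nth: "(A ** B) $ i $ j = (\<Sum>k\<in>UNIV. A $ i $ k * B $ k $ j)"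
  by (simp add: matrix_matrix_mult_def)

lemma matrix_mult_add_rdistrib: "(A + B) ** C = A ** C + B ** C"
  by (simp add: vec_eq_iff matrix_matrix_mult_nth distrib_right sum.distrib)

lemma outer_prod_mult_left: "A ** outer_prod x y = outer_prod (A *v x) y"
  by (simp add: vec_eq_iff matrix_matrix_mult_def outer_prod_def matrix_vector_mult_def
      sum_distrib_right mult.assoc)

lemma outer_prod_mult_right: "outer_prod x y ** A = outer_prod x (y v* A)"
  by (simp add: vec_eq_iff matrix_matrix_mult_def outer_prod_def vector_matrix_mult_def
      sum_distrib_left mult_ac)

lemma outer_prod_smult:
  "outer_prod (c *s x) y = outer_prod x (c *s y)"
  by (simp add: vec_eq_iff outer_prod_def mult_ac)

lemma matrix_inv_unique:
  fixes A B :: "'a::comm_ring_1^'n^'n"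
  assumes "A ** B = mat 1" "B ** A = mat 1"
  shows "invertible A" "matrix_inv A = B"
proof -
  show "invertible A" using assms by (auto simp: invertible_def)
  have "matrix_inv A ** A = mat 1"
    unfolding matrix_inv_def by (rule someI2[of _ B]) (use assms in auto)
  then have "matrix_inv A ** A ** B = B" by simp
  then show "matrix_inv A = B" using assms by (simp flip: matrix_mul_assoc)
qed

text \<open>Summing entries gives the two normalisations, and the product \<open>W L W\<close>
  carries the identity for \<beta> over to \<alpha>. The proposed inverse is then checked by
  multiplying it with \<open>W\<close> on both sides.\<close>

lemma bag_identities:
  fixes W L :: "'a::comm_ring_1^'n^'n" and \<alpha> \<beta> :: "'a^'n"
  assumes Lj: "L *v all_ones = 0" and jL: "all_ones v* L = 0"
    and LW: "L ** W + mat 1 = outer_prod \<beta> all_ones"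
    and WL: "W ** L + mat 1 = outer_prod all_ones \<alpha>"
    and W\<beta>: "W *v \<beta> = lam *s all_ones"
  shows "scalar_product \<alpha> all_ones = 1" "scalar_product all_ones \<beta> = 1"
    "\<alpha> v* W = lam *s all_ones"
    "lam dvd 1 \<Longrightarrow> invertible W"
    "lam dvd 1 \<Longrightarrow> matrix_inv W = - L + outer_prod (ring_inv lam *s \<beta>) \<alpha>"
proof -
  let ?j = "all_ones :: 'a^'n"
  have Lj': "(\<Sum>k\<in>UNIV. L $ i $ k) = 0" for i
    using Lj by (simp add: vec_eq_iff matrix_vector_mult_def all_ones_def)
  have jL': "(\<Sum>k\<in>UNIV. L $ k $ i) = 0" for i
    using jL by (simp add: vec_eq_iff vector_matrix_mult_def all_ones_def)
  \<comment> \<open>The column sums of \<open>L ** W\<close> vanish because those of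
    \<open>L\<close> do, so only the identity contributes.\<close>
  have "(\<Sum>i\<in>UNIV. (L ** W + mat 1) $ i $ y) = 1" for y
  proof -
    have "(\<Sum>i\<in>UNIV. (L ** W) $ i $ y) = (\<Sum>k\<in>UNIV. (\<Sum>i\<in>UNIV. L $ i $ k) * W $ k $ y)"
      unfolding matrix_matrix_mult_nth sum_distrib_right by (rule sum.swap)
    then show ?thesis by (simp add: sum.distrib jL' mat_def)
  qed
  then show "scalar_product all_ones \<beta> = 1"
    unfolding LW by (simp add: outer_prod_def scalar_product_def all_ones_def)
  have "(\<Sum>i\<in>UNIV. (W ** L + mat 1) $ y $ i) = 1" for y
  proof -
    have "(\<Sum>i\<in>UNIV. (W ** L) $ y $ i) = (\<Sum>k\<in>UNIV. W $ y $ k * (\<Sum>i\<in>UNIV. L $ k $ i))"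
      unfolding matrix_matrix_mult_nth sum_distrib_left by (rule sum.swap)
    then show ?thesis by (simp add: sum.distrib Lj' mat_def)
  qed
  then show "scalar_product \<alpha> all_ones = 1"
    unfolding WL by (simp add: outer_prod_def scalar_product_def all_ones_def)
  \<comment> \<open>\<open>W L W + W\<close> is bracketed in two ways, which relates
    \<open>\<alpha> v* W\<close> to \<open>W *v \<beta>\<close>.\<close>
  have "outer_prod ?j (\<alpha> v* W) = (W ** L + mat 1) ** W"
    unfolding WL by (simp add: outer_prod_mult_right)
  also have "\<dots> = W ** (L ** W + mat 1)"
    by (simp add: matrix_add_ldistrib matrix_mult_add_rdistrib matrix_mul_assoc)
  also have "\<dots> = outer_prod (W *v \<beta>) ?j"
    unfolding LW by (simp add: outer_prod_mult_left)
  finally show \<alpha>W: "\<alpha> v* W = lam *s all_ones"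
    unfolding W\<beta> by (simp add: vec_eq_iff outer_prod_def all_ones_def)
  let ?X = "- L + outer_prod (ring_inv lam *s \<beta>) \<alpha>"
  have LW': "L ** W = outer_prod \<beta> ?j - mat 1" and WL': "W ** L = outer_prod ?j \<alpha> - mat 1"
    using LW WL by (simp_all add: algebra_simps)
  assume "lam dvd 1"
  then have inv: "lam * (ring_inv lam * c) = c" for c
    using ring_inv_right[of lam] by (simp flip: mult.assoc)
  have "W ** outer_prod (ring_inv lam *s \<beta>) \<alpha> = outer_prod ?j \<alpha>"
    unfolding outer_prod_smult outer_prod_mult_left W\<beta>
    by (simp add: inv vec_eq_iff outer_prod_def all_ones_def mult_ac)
  moreover have "W ** (- L) = - (W ** L)"
    by (simp add: vec_eq_iff matrix_matrix_mult_nth sum_negf)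
  \<comment> \<open>\<open>W ** (- L)\<close> is the identity minus
    \<open>outer_prod ?j \<alpha>\<close>, and the rank-one term of \<open>?X\<close> restores what
    is subtracted.\<close>
  ultimately have 1: "W ** ?X = mat 1"
    unfolding matrix_add_ldistrib by (simp add: WL')
  have "outer_prod (ring_inv lam *s \<beta>) \<alpha> ** W = outer_prod \<beta> ?j"
    unfolding outer_prod_mult_right \<alpha>W
    by (simp add: inv vec_eq_iff outer_prod_def all_ones_def mult_ac)
  moreover have "(- L) ** W = - (L ** W)"
    by (simp add: vec_eq_iff matrix_matrix_mult_nth sum_negf)
  ultimately have 2: "?X ** W = mat 1"
    unfolding matrix_mult_add_rdistrib by (simp add: LW')
  show "invertible W" "matrix_inv W = ?X" by (rule matrix_inv_unique[OF 1 2])+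
qed

section \<open>Distances in cactoid digraphs\<close>

context cactoid
begin

text \<open>An entry of \<open>distance_matrix\<close> without the case for \<open>x = y\<close>: at
  a vertex the empty path gives \<open>0\<close> anyway. The uniform form suits additivity along
  paths.\<close>

definition path_weight :: "('e \<Rightarrow> 'a::comm_ring_1) \<Rightarrow> 'v \<Rightarrow> 'v \<Rightarrow> 'a" where
  "path_weight wt x y = sum_list (map wt (THE p. apath x p y))"

lemma path_weight_apath: "apath x p y \<Longrightarrow> path_weight wt x y = sum_list (map wt p)"
  unfolding path_weight_def using apath_unique by (metis the_equality)

lemma path_weight_self: "x \<in> verts G \<Longrightarrow> path_weight wt x x = 0"
  using path_weight_apath[of x "[]" x wt] by (simp add: apath_Nil_iff)

lemma obtain_apath:
  assumes "x \<in> verts G" "y \<in> verts G"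
  obtains p where "apath x p y"
proof -
  have "x \<rightarrow>\<^sup>* y" using sc assms by (simp add: strongly_connected_def)
  then show ?thesis using that reachable_apath by blast
qed

lemma apath_split:
  assumes "apath x p y" "z \<in> set (awalk_verts x p)"
  obtains q r where "p = q @ r" "apath x q z" "apath z r y"
proof -
  have "awalk x p y" using assms by (simp add: apath_def)
  from awalk_decomp[OF this assms(2)] obtain q r where
    *: "p = q @ r" "awalk x q z" "awalk z r y" by blast
  moreover have "awlast x q = z" using *(2) by auto
  ultimately have "apath x q z" "apath z r y" using assms(1) by (auto simp: apath_append_iff)
  then show ?thesis using * that by blast
qed

lemma path_weight_split:
  assumes "apath x p y" "z \<in> set (awalk_verts x p)"
  shows "path_weight wt x y = path_weight wt x z + path_weight wt z y"
proof -
  obtain q r where "p = q @ r" "apath x q z" "apath z r y" using apath_split[OF assms] .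
  then show ?thesis using assms(1) by (simp add: path_weight_apath)
qed

lemma path_weight_first_arc:
  assumes "apath x (a # p) y"
  shows "path_weight wt x y = wt a + path_weight wt (head G a) y"
proof -
  have "apath (head G a) p y" using assms by (simp add: apath_Cons_iff)
  then show ?thesis using assms by (simp add: path_weight_apath)
qed

text \<open>If \<open>a\<close> cannot be put in front of the path from its head to
  \<open>y\<close>, that path already visits the tail of \<open>a\<close> and can be split
  there.\<close>

lemma path_weight_not_first_arc:
  assumes a: "a \<in> arcs G" and y: "y \<in> verts G" and no: "\<nexists>p. apath (tail G a) (a # p) y"
  shows "path_weight wt (head G a) y =
    path_weight wt (head G a) (tail G a) + path_weight wt (tail G a) y"
proof -
  obtain q where q: "apath (head G a) q y" using obtain_apath a y by (meson head_in_verts)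
  then have "tail G a \<in> set (awalk_verts (head G a) q)"
    using no a by (auto simp: apath_Cons_iff)
  then show ?thesis using q path_weight_split by blast
qed

lemma path_weight_last_arc:
  assumes "apath x (p @ [a]) y"
  shows "path_weight wt x y = path_weight wt x (tail G a) + wt a"
proof -
  have "awlast x p = tail G a" using assms by (auto simp: apath_append_iff apath_Cons_iff)
  then have "apath x p (tail G a)" using assms by (auto simp: apath_append_iff)
  then show ?thesis using assms by (simp add: path_weight_apath)
qed

text \<open>If \<open>a\<close> cannot be appended to the path from \<open>x\<close> to its tail,
  that path already visits the head of \<open>a\<close>.\<close>

lemma path_weight_not_last_arc:
  assumes a: "a \<in> arcs G" and x: "x \<in> verts G" and no: "\<nexists>p. apath x (p @ [a]) (head G a)"
  shows "path_weight wt x (tail G a) =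
    path_weight wt x (head G a) + path_weight wt (head G a) (tail G a)"
proof -
  obtain q where q: "apath x q (tail G a)" using obtain_apath a x by (meson tail_in_verts)
  have "awlast x q = tail G a" using q by (auto simp: apath_def)
  moreover have "apath (tail G a) [a] (head G a)"
    using a no_loops by (auto simp: apath_Cons_iff apath_Nil_iff)
  ultimately have "head G a \<in> set (awalk_verts x q)"
    using no q by (auto simp: apath_append_iff)
  then show ?thesis using q path_weight_split by blast
qed

lemma block_in_arc_unique:
  assumes "H \<in> blocks G" "a \<in> arcs H" "b \<in> arcs H" "head G a = head G b"
  shows "a = b"
proof -
  obtain m v e where cyc: "cycle_labelling H m v e" using block_cycle assms by blast
  have inj: "inj_on v {..<m}" and "arcs H = e ` {..<m}" and m: "2 \<le> m"
    using cyc by (auto simp: cycle_labelling_def)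
  then obtain k l where kl: "k < m" "a = e k" "l < m" "b = e l" using assms by auto
  then have "v (Suc k mod m) = v (Suc l mod m)"
    using cycle_labelling_arc(3)[OF block_subgraph[OF assms(1)] cyc] assms(4) by metis
  then have "Suc k mod m = Suc l mod m" using inj m by (auto dest: inj_onD)
  then have "k = l" using kl by (auto simp: mod_Suc split: if_splits)
  then show ?thesis using kl by simp
qed

lemma block_arc_ends:
  assumes "H \<in> blocks G" "a \<in> arcs H"
  shows "a \<in> arcs G" "tail G a \<in> verts H" "head G a \<in> verts H"
  using assms block_subgraph[OF assms(1)] wf_digraph.wellformed[of H a]
  by (auto simp: subgraph_def compatible_def)

end

section \<open>Cactoid digraphs with labelled blocks\<close>

locale labelled_cactoid = cactoid G for G :: "('v::finite, 'e) pre_digraph" (structure) +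
  fixes r :: nat and B :: "nat \<Rightarrow> ('v, 'e) pre_digraph" and n :: "nat \<Rightarrow> nat"
    and v :: "nat \<Rightarrow> nat \<Rightarrow> 'v" and e :: "nat \<Rightarrow> nat \<Rightarrow> 'e" and wt :: "'e \<Rightarrow> 'a::comm_ring_1"
  assumes verts_UNIV: "verts G = UNIV"
    and blocks_bij: "bij_betw B {1..r} (blocks G)"
    and labelling: "i \<in> {1..r} \<Longrightarrow> cycle_labelling (B i) (n i) (v i) (e i)"
    and invertible_weight: "i \<in> {1..r} \<Longrightarrow> first_weight (n i) (\<lambda>k. wt (e i k)) dvd 1"
begin

abbreviation w :: "nat \<Rightarrow> nat \<Rightarrow> 'a" where "w i k \<equiv> wt (e i k)"

abbreviation fw :: "nat \<Rightarrow> 'a" where "fw i \<equiv> first_weight (n i) (w i)"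

abbreviation d :: "'v \<Rightarrow> 'v \<Rightarrow> 'a" where "d \<equiv> path_weight wt"

definition pos :: "nat \<Rightarrow> 'v \<Rightarrow> nat" where "pos i = the_inv_into {..<n i} (v i)"

text \<open>In a block through \<open>u\<close> exactly one arc leaves \<open>u\<close> and one
  enters it. \<open>out_arc\<close> and \<open>in_arc\<close> select them and are meaningful only
  when \<open>u\<close> lies in block \<open>i\<close>.\<close>

definition out_arc :: "nat \<Rightarrow> 'v \<Rightarrow> 'e" where "out_arc i u = e i (pos i u)"

definition in_arc :: "nat \<Rightarrow> 'v \<Rightarrow> 'e" where "in_arc i u = e i ((pos i u + n i - 1) mod n i)"

lemma block: "i \<in> {1..r} \<Longrightarrow> B i \<in> blocks G"
  using blocks_bij by (auto simp: bij_betw_def)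

lemma block_inj: "i \<in> {1..r} \<Longrightarrow> j \<in> {1..r} \<Longrightarrow> B i = B j \<Longrightarrow> i = j"
  using blocks_bij by (auto simp: bij_betw_def dest: inj_onD)

lemma block_surj: "H \<in> blocks G \<Longrightarrow> \<exists>i\<in>{1..r}. H = B i"
  using blocks_bij by (auto simp: bij_betw_def)

lemma labelled:
  assumes "i \<in> {1..r}"
  shows "2 \<le> n i" "inj_on (v i) {..<n i}" "verts (B i) = v i ` {..<n i}" "arcs (B i) = e i ` {..<n i}"
  using labelling[OF assms] by (auto simp: cycle_labelling_def)

lemmas arc = cycle_labelling_arc[OF block_subgraph[OF block] labelling]
lemmas path = cycle_path_apath[OF block_subgraph[OF block] labelling]

lemma fw_inv: "i \<in> {1..r} \<Longrightarrow> ring_inv (fw i) * fw i = 1"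
  using ring_inv_right[OF invertible_weight] by (simp add: mult.commute)

lemma pos_vertex: "i \<in> {1..r} \<Longrightarrow> k < n i \<Longrightarrow> pos i (v i k) = k"
  unfolding pos_def using labelled by (intro the_inv_into_f_f) auto

lemma pos_less: "i \<in> {1..r} \<Longrightarrow> u \<in> verts (B i) \<Longrightarrow> pos i u < n i"
  using labelled(3) pos_vertex by auto

lemma vertex_pos: "i \<in> {1..r} \<Longrightarrow> u \<in> verts (B i) \<Longrightarrow> v i (pos i u) = u"
  using labelled(3) pos_vertex by auto

lemma out_arc:
  assumes "i \<in> {1..r}" "u \<in> verts (B i)"
  shows "out_arc i u \<in> arcs (B i)" "tail G (out_arc i u) = u"
    "head G (out_arc i u) = v i (Suc (pos i u) mod n i)"
  using pos_less[OF assms] arc[OF assms(1,1)] labelled(4)[OF assms(1)] vertex_pos[OF assms]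
  by (auto simp: out_arc_def)

lemma in_arc:
  assumes "i \<in> {1..r}" "u \<in> verts (B i)"
  shows "in_arc i u \<in> arcs (B i)" "head G (in_arc i u) = u"
    "tail G (in_arc i u) = v i ((pos i u + n i - 1) mod n i)"
proof -
  note l = pos_less[OF assms] labelled(1)[OF assms(1)]
  have k: "(pos i u + n i - 1) mod n i < n i" using l by simp
  have "Suc ((pos i u + n i - 1) mod n i) mod n i = Suc (pos i u + n i - 1) mod n i"
    by (rule mod_Suc_eq)
  also have "\<dots> = pos i u" using l by simp
  finally have s: "Suc ((pos i u + n i - 1) mod n i) mod n i = pos i u" .
  show "in_arc i u \<in> arcs (B i)" "head G (in_arc i u) = u"
    "tail G (in_arc i u) = v i ((pos i u + n i - 1) mod n i)"
    using k s arc[OF assms(1,1) k] labelled(4)[OF assms(1)] vertex_pos[OF assms]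
    by (auto simp: in_arc_def)
qed

lemma in_arc_eqI:
  assumes "i \<in> {1..r}" "a \<in> arcs (B i)" shows "in_arc i (head G a) = a"
  using block_in_arc_unique[OF block[OF assms(1)]] in_arc[OF assms(1)]
    block_arc_ends[OF block[OF assms(1)] assms(2)] assms by simp

lemma out_arc_eqI:
  assumes "i \<in> {1..r}" "a \<in> arcs (B i)" shows "out_arc i (tail G a) = a"
  using block_out_arc_unique[OF block[OF assms(1)]] out_arc[OF assms(1)]
    block_arc_ends[OF block[OF assms(1)] assms(2)] assms by simp

lemma path_weight_cycle:
  assumes "i \<in> {1..r}" "j < n i" "l < n i"
  shows "d (v i j) (v i ((j + l) mod n i)) = (\<Sum>t<l. w i ((j + t) mod n i))"
  using path_weight_apath[OF path[OF assms(1,1,2,3)]]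
  by (simp add: cycle_path_def sum_list_sum_nth comp_def atLeast0LessThan)

text \<open>The way back from the head of \<open>a\<close> uses every arc of its cycle except
  \<open>a\<close>.\<close>

lemma path_weight_return:
  assumes i: "i \<in> {1..r}" and a: "a \<in> arcs (B i)"
  shows "d (head G a) (tail G a) = fw i - wt a"
proof -
  obtain k where k: "k < n i" "a = e i k" using a labelled(4)[OF i] by auto
  \<comment> \<open>\<open>m\<close> is the number of arcs on the way back.\<close>
  obtain m where m: "n i = Suc m" using labelled(1)[OF i] by (cases "n i") auto
  let ?j = "Suc k mod n i"
  have "(?j + m) mod n i = (Suc k + m) mod n i" by (rule mod_add_left_eq)
  also have "Suc k + m = k + n i" using m by simp
  also have "\<dots> mod n i = k" using k by simp
  finally have "d (head G a) (tail G a) = (\<Sum>t<m. w i ((?j + t) mod n i))"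
    using path_weight_cycle[OF i, of ?j m] arc[OF i i k(1)] k m by simp
  also have "\<dots> = (\<Sum>t<m. w i ((k + Suc t) mod n i))"
    by (simp add: mod_add_left_eq)
  \<comment> \<open>Putting back the term for \<open>t = 0\<close>, the weight of \<open>a\<close>,
    completes the sum over the cycle.\<close>
  also have "\<dots> = (\<Sum>t<n i. w i ((k + t) mod n i)) - wt a"
    using k unfolding m sum.lessThan_Suc_shift by simp
  finally show ?thesis using sum_cyclic_shift[of "w i" k "n i"] by (simp add: first_weight_def)
qed

section \<open>First and last arcs of paths\<close>

abbreviation is_first :: "'e \<Rightarrow> 'v \<Rightarrow> bool" where
  "is_first a y \<equiv> \<exists>p. apath (tail G a) (a # p) y"

abbreviation is_last :: "'v \<Rightarrow> 'e \<Rightarrow> bool" where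
  "is_last x a \<equiv> \<exists>p. apath x (p @ [a]) (head G a)"

text \<open>The difference is the weight of the arc if the arc comes first on the path to
  \<open>y\<close>, and that weight minus \<open>fw i\<close> otherwise. After division by
  \<open>fw i\<close> the cases differ by \<open>1\<close>, which \<open>of_bool\<close>
  records.\<close>

lemma out_arc_difference:
  assumes i: "i \<in> {1..r}" and u: "u \<in> verts (B i)"
  shows "ring_inv (fw i) * (d u y - d (head G (out_arc i u)) y) =
    cycle_beta (n i) (v i) (w i) u - 1 + of_bool (is_first (out_arc i u) y)"
proof -
  let ?a = "out_arc i u"
  note a = out_arc[OF i u]
  have beta: "cycle_beta (n i) (v i) (w i) u = wt ?a * ring_inv (fw i)"
    by (simp add: cycle_beta_def out_arc_def pos_def)
  show ?thesis
  proof (cases "is_first ?a y")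
    case True
    then show ?thesis using path_weight_first_arc[of u ?a _ y wt] a
      by (auto simp: beta mult.commute)
  next
    case False
    have "d (head G ?a) y = fw i - wt ?a + d u y"
      using path_weight_not_first_arc[of ?a y wt] False block_arc_ends[OF block[OF i] a(1)]
        path_weight_return[OF i a(1)] a verts_UNIV by auto
    then have "d u y - d (head G ?a) y = wt ?a - fw i" by simp
    then show ?thesis using False fw_inv[OF i]
      by (simp only: beta) (simp add: right_diff_distrib mult.commute)
  qed
qed

text \<open>Mirror image of \<open>out_arc_difference\<close>: the arc entering \<open>u\<close> is
  last on the path from \<open>x\<close>, or the path to its tail passes through \<open>u\<close>
  and goes round the cycle.\<close>

lemma in_arc_difference:
  assumes i: "i \<in> {1..r}" and u: "u \<in> verts (B i)"
  shows "ring_inv (fw i) * (d x u - d x (tail G (in_arc i u))) =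
    cycle_alpha (n i) (v i) (w i) u - 1 + of_bool (is_last x (in_arc i u))"
proof -
  let ?a = "in_arc i u"
  note a = in_arc[OF i u]
  have alpha: "cycle_alpha (n i) (v i) (w i) u = wt ?a * ring_inv (fw i)"
    by (simp add: cycle_alpha_def in_arc_def pos_def)
  show ?thesis
  proof (cases "is_last x ?a")
    case True
    then show ?thesis using path_weight_last_arc[of x _ ?a u wt] a
      by (auto simp: alpha mult.commute)
  next
    case False
    have "d x (tail G ?a) = d x u + (fw i - wt ?a)"
      using path_weight_not_last_arc[of ?a x wt] False block_arc_ends[OF block[OF i] a(1)]
        path_weight_return[OF i a(1)] a verts_UNIV by auto
    then have "d x u - d x (tail G ?a) = wt ?a - fw i" by simp
    then show ?thesis using False fw_inv[OF i]
      by (simp only: alpha) (simp add: right_diff_distrib mult.commute)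
  qed
qed

lemma arc_block_index:
  assumes "a \<in> arcs G"
  obtains i where "i \<in> {1..r}" "a \<in> arcs (B i)"
  using arc_in_block[OF sc assms] block_surj that by blast

text \<open>For \<open>u \<noteq> y\<close> the unique path to \<open>y\<close> has one first arc,
  which lies in exactly one block; for \<open>u = y\<close> the simple path is empty.\<close>

lemma sum_is_first:
  "(\<Sum>i\<in>Bl r B u. of_bool (is_first (out_arc i u) y)) = (of_bool (u \<noteq> y) :: 'a)"
proof (cases "u = y")
  case True
  have "\<not> is_first (out_arc i u) y" if "i \<in> Bl r B u" for i
  proof -
    have "tail G (out_arc i u) = u" using that out_arc(2) by (auto simp: Bl_def)
    then show ?thesis using True apath_nonempty_ends[of u "out_arc i u # _" y] by auto
  qed
  then show ?thesis using True by simp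
next
  case False
  obtain p where p: "apath u p y" using obtain_apath verts_UNIV by blast
  then obtain a q where q: "p = a # q" using False by (cases p) (auto simp: apath_Nil_iff)
  then have a: "a \<in> arcs G" "tail G a = u" using p by (auto simp: apath_Cons_iff)
  obtain j where j: "j \<in> {1..r}" "a \<in> arcs (B j)" using arc_block_index a(1) .
  have ju: "j \<in> Bl r B u" using j a block_arc_ends[OF block[OF j(1)]] by (auto simp: Bl_def)
  have "is_first (out_arc i u) y \<longleftrightarrow> i = j" if "i \<in> Bl r B u" for i
  proof -
    have i: "i \<in> {1..r}" "u \<in> verts (B i)" using that by (auto simp: Bl_def)
    note o = out_arc[OF i]
    show ?thesis
    proof
      assume "is_first (out_arc i u) y"
      then have "out_arc i u = a" using o(2) p q apath_unique by (metis list.inject)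
      then show "i = j" using block_arc_unique[OF block[OF i(1)] block[OF j(1)]] o j block_inj i by auto
    next
      assume "i = j"
      then have "out_arc i u = a" using out_arc_eqI[OF j] a by simp
      then show "is_first (out_arc i u) y" using p q a by auto
    qed
  qed
  then have "(\<Sum>i\<in>Bl r B u. of_bool (is_first (out_arc i u) y)) = (\<Sum>i\<in>Bl r B u. of_bool (i = j) :: 'a)"
    by (intro sum.cong) auto
  then show ?thesis using ju False by (simp add: Bl_def)
qed

text \<open>The same count at the end of the path: its last arc lies in exactly one block, unless
  the path is empty.\<close>

lemma sum_is_last:
  "(\<Sum>i\<in>Bl r B u. of_bool (is_last x (in_arc i u))) = (of_bool (x \<noteq> u) :: 'a)"
proof (cases "x = u")
  case True
  have "\<not> is_last x (in_arc i u)" if "i \<in> Bl r B u" for i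
  proof -
    have "head G (in_arc i u) = u" using that in_arc(2) by (auto simp: Bl_def)
    then show ?thesis using True apath_nonempty_ends[of x "_ @ [in_arc i u]" u] by auto
  qed
  then show ?thesis using True by simp
next
  case False
  obtain p where p: "apath x p u" using obtain_apath verts_UNIV by blast
  then obtain q a where q: "p = q @ [a]" using False
    by (cases p rule: rev_cases) (auto simp: apath_Nil_iff)
  then have a: "a \<in> arcs G" "head G a = u" using p
    by (auto simp: apath_append_iff apath_Cons_iff apath_Nil_iff)
  obtain j where j: "j \<in> {1..r}" "a \<in> arcs (B j)" using arc_block_index a(1) .
  have ju: "j \<in> Bl r B u" using j a block_arc_ends[OF block[OF j(1)]] by (auto simp: Bl_def)
  have "is_last x (in_arc i u) \<longleftrightarrow> i = j" if "i \<in> Bl r B u" for i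
  proof -
    have i: "i \<in> {1..r}" "u \<in> verts (B i)" using that by (auto simp: Bl_def)
    note o = in_arc[OF i]
    show ?thesis
    proof
      assume "is_last x (in_arc i u)"
      then have "in_arc i u = a" using o(2) p q apath_unique by (metis last_snoc)
      then show "i = j" using block_arc_unique[OF block[OF i(1)] block[OF j(1)]] o j block_inj i by auto
    next
      assume "i = j"
      then have "in_arc i u = a" using in_arc_eqI[OF j] a by simp
      then show "is_last x (in_arc i u)" using p q a by auto
    qed
  qed
  then have "(\<Sum>i\<in>Bl r B u. of_bool (is_last x (in_arc i u))) = (\<Sum>i\<in>Bl r B u. of_bool (i = j) :: 'a)"
    by (intro sum.cong) auto
  then show ?thesis using ju False by (simp add: Bl_def)
qed

end

section \<open>The glued bag\<close>

lemma sum_glue_mat_row: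
  "(\<Sum>z\<in>UNIV. glue_mat r B M $ u $ z * f z) =
    (\<Sum>i\<in>Bl r B u. \<Sum>z\<in>verts (B i). M i u z * f z)"
proof -
  have "(\<Sum>z\<in>UNIV. glue_mat r B M $ u $ z * f z) =
      (\<Sum>i = 1..r. \<Sum>z\<in>UNIV. if u \<in> verts (B i) \<and> z \<in> verts (B i) then M i u z * f z else 0)"
    unfolding sum.swap[of _ UNIV]
    by (simp add: glue_mat_def sum_distrib_right if_distrib[of "\<lambda>x. x * _"] cong: if_cong)
  also have "\<dots> = (\<Sum>i = 1..r. if u \<in> verts (B i) then \<Sum>z\<in>verts (B i). M i u z * f z else 0)"
    by (intro sum.cong refl) (simp flip: sum.inter_restrict)
  finally show ?thesis unfolding Bl_def by (simp only: sum.inter_filter[OF finite_atLeastAtMost])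
qed

lemma sum_glue_mat_column:
  "(\<Sum>u\<in>UNIV. f u * glue_mat r B M $ u $ z) =
    (\<Sum>i\<in>Bl r B z. \<Sum>u\<in>verts (B i). f u * M i u z)"
proof -
  have "(\<Sum>u\<in>UNIV. f u * glue_mat r B M $ u $ z) =
      (\<Sum>i = 1..r. \<Sum>u\<in>UNIV. if z \<in> verts (B i) \<and> u \<in> verts (B i) then f u * M i u z else 0)"
    unfolding sum.swap[of _ UNIV]
    by (simp add: glue_mat_def sum_distrib_left if_distrib[of "\<lambda>x. _ * x"] conj_commute cong: if_cong)
  also have "\<dots> = (\<Sum>i = 1..r. if z \<in> verts (B i) then \<Sum>u\<in>verts (B i). f u * M i u z else 0)"
    by (intro sum.cong refl) (simp flip: sum.inter_restrict)
  finally show ?thesis unfolding Bl_def by (simp only: sum.inter_filter[OF finite_atLeastAtMost])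
qed

text \<open>Double counting of the incidences between vertices and blocks.\<close>

lemma sum_Bl_swap:
  fixes B :: "nat \<Rightarrow> ('v::finite, 'e) pre_digraph"
  shows "(\<Sum>y\<in>UNIV. \<Sum>i\<in>Bl r B y. F i y) = (\<Sum>i = 1..r. \<Sum>y\<in>verts (B i). F i y)"
  using sum.swap_restrict[of UNIV "{1..r}" "\<lambda>y i. F i y" "\<lambda>y i. y \<in> verts (B i)"]
  by (simp add: Bl_def)

context labelled_cactoid
begin

section \<open>Products with the glued matrix \<open>L\<close>\<close>

lemma cycle_perm_conv:
  assumes "i \<in> {1..r}"
  shows "cycle_perm (n i) (v i) u z = of_bool (\<exists>a\<in>arcs (B i). tail G a = u \<and> head G a = z)"
  using arc[OF assms assms] labelled(4)[OF assms] by (auto simp: cycle_perm_def)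

text \<open>The only arc of the block that leaves \<open>u\<close> is \<open>out_arc i u\<close>, so
  row \<open>u\<close> of \<open>cycle_L\<close> acts as a scaled difference along this arc.\<close>

lemma cycle_L_row:
  assumes i: "i \<in> {1..r}" and u: "u \<in> verts (B i)"
  shows "(\<Sum>z\<in>verts (B i). cycle_L (n i) (v i) (w i) u z * f z) =
    ring_inv (fw i) * (f u - f (head G (out_arc i u)))"
proof -
  note o = out_arc[OF i u]
  let ?h = "head G (out_arc i u)"
  have h: "?h \<in> verts (B i)" using block_arc_ends[OF block[OF i] o(1)] by simp
  have perm: "cycle_perm (n i) (v i) u z = of_bool (z = ?h)" for z
    using o out_arc_eqI[OF i] by (auto simp: cycle_perm_conv[OF i])
  have "cycle_L (n i) (v i) (w i) u z * f z =
      ring_inv (fw i) * ((if u = z then f z else 0) - (if z = ?h then f z else 0))" for z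
    by (simp add: cycle_L_def perm mult.commute mult.left_commute right_diff_distrib)
  then have "(\<Sum>z\<in>verts (B i). cycle_L (n i) (v i) (w i) u z * f z) =
      ring_inv (fw i) * ((\<Sum>z\<in>verts (B i). if u = z then f z else 0)
        - (\<Sum>z\<in>verts (B i). if z = ?h then f z else 0))"
    by (simp only: sum_distrib_left[symmetric] sum_subtractf)
  then show ?thesis using u h by simp
qed

text \<open>Column \<open>z\<close> sees only the arc entering \<open>z\<close>, because a block has
  one arc into each of its vertices.\<close>

lemma cycle_L_column:
  assumes i: "i \<in> {1..r}" and z: "z \<in> verts (B i)"
  shows "(\<Sum>u\<in>verts (B i). f u * cycle_L (n i) (v i) (w i) u z) =
    ring_inv (fw i) * (f z - f (tail G (in_arc i z)))"
proof -
  note o = in_arc[OF i z]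
  let ?t = "tail G (in_arc i z)"
  have t: "?t \<in> verts (B i)" using block_arc_ends[OF block[OF i] o(1)] by simp
  have perm: "cycle_perm (n i) (v i) u z = of_bool (u = ?t)" for u
    using o in_arc_eqI[OF i] by (auto simp: cycle_perm_conv[OF i])
  have "f u * cycle_L (n i) (v i) (w i) u z =
      ring_inv (fw i) * ((if u = z then f u else 0) - (if u = ?t then f u else 0))" for u
    by (simp add: cycle_L_def perm mult.commute mult.left_commute right_diff_distrib)
  then have "(\<Sum>u\<in>verts (B i). f u * cycle_L (n i) (v i) (w i) u z) =
      ring_inv (fw i) * ((\<Sum>u\<in>verts (B i). if u = z then f u else 0)
        - (\<Sum>u\<in>verts (B i). if u = ?t then f u else 0))"
    by (simp only: sum_distrib_left[symmetric] sum_subtractf)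
  then show ?thesis using z t by simp
qed

abbreviation L :: "'a^'v^'v" where "L \<equiv> glue_mat r B (\<lambda>i. cycle_L (n i) (v i) (w i))"

abbreviation W :: "'a^'v^'v" where "W \<equiv> distance_matrix G wt"

abbreviation \<alpha> :: "'a^'v" where "\<alpha> \<equiv> glue_vec r B (\<lambda>i. cycle_alpha (n i) (v i) (w i))"

abbreviation \<beta> :: "'a^'v" where "\<beta> \<equiv> glue_vec r B (\<lambda>i. cycle_beta (n i) (v i) (w i))"

lemma W_nth: "W $ x $ y = d x y"
  using path_weight_self[of x wt] verts_UNIV
  by (cases "x = y") (simp_all add: distance_matrix_def path_weight_def)

lemma L_all_ones: "L *v all_ones = 0"
proof -
  have "(\<Sum>z\<in>UNIV. L $ u $ z * 1) = 0" for u
    unfolding sum_glue_mat_row by (rule sum.neutral, rule ballI) (subst cycle_L_row, auto simp: Bl_def)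
  then show ?thesis by (simp add: vec_eq_iff matrix_vector_mult_def all_ones_def)
qed

lemma all_ones_L: "all_ones v* L = 0"
proof -
  have "(\<Sum>u\<in>UNIV. 1 * L $ u $ z) = 0" for z
    unfolding sum_glue_mat_column by (rule sum.neutral, rule ballI) (subst cycle_L_column, auto simp: Bl_def)
  then show ?thesis by (simp add: vec_eq_iff vector_matrix_mult_def all_ones_def)
qed

text \<open>Each block at \<open>u\<close> contributes \<open>cycle_beta\<close> minus
  \<open>1\<close>, and exactly one contributes an additional \<open>1\<close> when
  \<open>u \<noteq> y\<close>. This accounts for the correction by \<open>bi\<close> and
  \<open>1\<close> in \<open>glue_vec\<close>.\<close>

lemma L_W: "L ** W + mat 1 = outer_prod \<beta> all_ones"
proof -
  have "(L ** W) $ u $ y = \<beta> $ u - of_bool (u = y)" for u y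
  proof -
    have "(L ** W) $ u $ y =
        (\<Sum>i\<in>Bl r B u. ring_inv (fw i) * (d u y - d (head G (out_arc i u)) y))"
      unfolding matrix_matrix_mult_nth sum_glue_mat_row W_nth
      by (intro sum.cong refl cycle_L_row) (auto simp: Bl_def)
    also have "\<dots> = (\<Sum>i\<in>Bl r B u. cycle_beta (n i) (v i) (w i) u - 1
        + of_bool (is_first (out_arc i u) y))"
      by (intro sum.cong refl out_arc_difference) (auto simp: Bl_def)
    also have "\<dots> = (\<Sum>i\<in>Bl r B u. cycle_beta (n i) (v i) (w i) u) - of_nat (bi r B u)
        + of_bool (u \<noteq> y)"
      by (simp only: sum.distrib sum_subtractf sum_is_first) (simp add: bi_def)
    finally show ?thesis by (simp add: glue_vec_def)
  qed
  then show ?thesis by (simp add: vec_eq_iff mat_def outer_prod_def all_ones_def)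
qed

text \<open>As for \<open>L_W\<close>, with columns of \<open>L\<close> and last arcs in place of
  rows and first arcs.\<close>

lemma W_L: "W ** L + mat 1 = outer_prod all_ones \<alpha>"
proof -
  have "(W ** L) $ x $ u = \<alpha> $ u - of_bool (x = u)" for x u
  proof -
    have "(W ** L) $ x $ u =
        (\<Sum>i\<in>Bl r B u. ring_inv (fw i) * (d x u - d x (tail G (in_arc i u))))"
      unfolding matrix_matrix_mult_nth sum_glue_mat_column W_nth
      by (intro sum.cong refl cycle_L_column) (auto simp: Bl_def)
    also have "\<dots> = (\<Sum>i\<in>Bl r B u. cycle_alpha (n i) (v i) (w i) u - 1
        + of_bool (is_last x (in_arc i u)))"
      by (intro sum.cong refl in_arc_difference) (auto simp: Bl_def)
    also have "\<dots> = (\<Sum>i\<in>Bl r B u. cycle_alpha (n i) (v i) (w i) u) - of_nat (bi r B u)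
        + of_bool (x \<noteq> u)"
      by (simp only: sum.distrib sum_subtractf sum_is_last) (simp add: bi_def)
    finally show ?thesis by (simp add: glue_vec_def)
  qed
  then show ?thesis by (simp add: vec_eq_iff mat_def outer_prod_def all_ones_def)
qed

text \<open>\<open>g\<close> is the vertex of the block nearest to \<open>x\<close> in number of
  arcs. The path to it meets the block only at \<open>g\<close>; continued along the cycle it gives
  the path to every \<open>y\<close>, which ends with an arc of the block exactly when
  \<open>y \<noteq> g\<close>.\<close>

lemma ex_gate:
  assumes i: "i \<in> {1..r}"
  shows "\<exists>g\<in>verts (B i). \<forall>y\<in>verts (B i).
    d x y = d x g + d g y \<and> (is_last x (in_arc i y) \<longleftrightarrow> y \<noteq> g)"
proof -
  note sub = block_subgraph[OF block[OF i]]
  let ?P = "\<lambda>p. \<exists>g\<in>verts (B i). apath x p g"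
  have "v i 0 \<in> verts (B i)" using labelled[OF i] by auto
  moreover obtain p0 where "apath x p0 (v i 0)" using obtain_apath verts_UNIV by blast
  ultimately have "?P p0" by blast
  then have "\<exists>p. ?P p \<and> (\<forall>q. ?P q \<longrightarrow> length p \<le> length q)"
    by (rule ex_has_least_nat)
  then obtain p where "?P p" and min: "\<And>q. ?P q \<Longrightarrow> length p \<le> length q"
    by (elim exE conjE) (rule that, assumption, erule allE, erule mp)
  then obtain g where g: "g \<in> verts (B i)" "apath x p g" by blast
  have last_p: "awlast x p = g" using g(2) by (auto simp: apath_def)
  \<comment> \<open>A block vertex on \<open>p\<close> before its end would give a shorter path into
    the block.\<close>
  have meet: "z = g" if z: "z \<in> verts (B i)" "z \<in> set (awalk_verts x p)" for z
  proof -
    obtain q s where qs: "p = q @ s" "apath x q z" "apath z s g" using apath_split[OF g(2) z(2)] .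
    then have "s = []" using min[of q] z by auto
    then show ?thesis using qs by (simp add: apath_Nil_iff)
  qed
  \<comment> \<open>Otherwise the tail of that arc, a block vertex other than \<open>g\<close>,
    would lie on \<open>p\<close>.\<close>
  have last_g: "\<not> is_last x (in_arc i g)"
  proof
    note o = in_arc[OF i g(1)]
    assume "is_last x (in_arc i g)"
    then have "in_arc i g \<in> set p" using g(2) o apath_unique by (metis in_set_conv_decomp)
    then have "tail G (in_arc i g) = g"
      using meet block_arc_ends[OF block[OF i] o(1)] awalk_verts_arc1 by blast
    then show False using o no_loops block_arc_ends[OF block[OF i] o(1)] by metis
  qed
  have "d x y = d x g + d g y \<and> (is_last x (in_arc i y) \<longleftrightarrow> y \<noteq> g)" if y: "y \<in> verts (B i)" for y
  proof -
    obtain l where l: "l < n i" "pos i y = (pos i g + l) mod n i"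
      and c: "apath (v i (pos i g)) (cycle_path (e i) (n i) (pos i g) l) (v i (pos i y))"
      using cycle_path_apath_between[OF sub labelling[OF i] pos_less[OF i g(1)] pos_less[OF i y]] .
    let ?c = "cycle_path (e i) (n i) (pos i g) l"
    have c: "apath g ?c y" using c vertex_pos[OF i] g y by simp
    then have cw: "awalk g ?c y" by (simp add: apath_def)
    have cB: "set ?c \<subseteq> arcs (B i)"
      using labelled[OF i] by (auto simp: cycle_path_def)
    have cv: "set (awalk_verts g ?c) \<subseteq> verts (B i)"
      using set_awalk_verts[OF cw] cB g block_arc_ends[OF block[OF i]] by auto
    have vc: "awalk_verts g ?c = g # tl (awalk_verts g ?c)"
      using cw by (metis awhd_of_awalk awalk_verts_non_Nil list.collapse)
    then have gc: "g \<notin> set (tl (awalk_verts g ?c))"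
      using c by (metis apath_def distinct.simps(2))
    \<comment> \<open>Beyond \<open>g\<close> the cycle stays in the block and so off
      \<open>p\<close>; hence the concatenation is simple.\<close>
    have "set (tl (awalk_verts g ?c)) \<subseteq> verts (B i)"
      using cv list.set_sel(2)[OF awalk_verts_non_Nil] by blast
    then have "set (awalk_verts x p) \<inter> set (tl (awalk_verts g ?c)) = {}"
      using meet gc by blast
    then have pc: "apath x (p @ ?c) y" using g(2) c last_p by (simp add: apath_append_iff)
    have "g \<in> set (awalk_verts x (p @ ?c))"
      using set_awalk_verts_append[of x p g ?c y] g(2) cw hd_in_awalk_verts(1)[OF cw]
      by (simp add: apath_def)
    then have "d x y = d x g + d g y" using path_weight_split pc by blast
    moreover have "is_last x (in_arc i y)" if "y \<noteq> g"
    proof -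
      have "?c \<noteq> []" using c that by (auto simp: apath_Nil_iff)
      then obtain c' a where ca: "?c = c' @ [a]" by (metis rev_exhaust)
      have "head G a = y" using cw ca by (simp add: awalk_Cons_iff awalk_Nil_iff)
      moreover have "a \<in> arcs (B i)" using cB ca by auto
      ultimately have "in_arc i y = a" using in_arc_eqI[OF i] by blast
      then show ?thesis using pc ca \<open>head G a = y\<close> by (metis append.assoc)
    qed
    ultimately show ?thesis using last_g by blast
  qed
  then show ?thesis using g(1) by blast
qed

text \<open>The second clause leaves only one choice: the gate is the one vertex of the block that
  is not reached from \<open>x\<close> through its arc within the block. If \<open>x\<close> lies in
  the block, this is \<open>x\<close>.\<close>

definition gate :: "'v \<Rightarrow> nat \<Rightarrow> 'v" where
  "gate x i = (SOME g. g \<in> verts (B i) \<and> (\<forall>y\<in>verts (B i).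
    d x y = d x g + d g y \<and> (is_last x (in_arc i y) \<longleftrightarrow> y \<noteq> g)))"

lemma gate:
  assumes "i \<in> {1..r}"
  shows "gate x i \<in> verts (B i)"
    and "y \<in> verts (B i) \<Longrightarrow> d x y = d x (gate x i) + d (gate x i) y"
    and "y \<in> verts (B i) \<Longrightarrow> is_last x (in_arc i y) \<longleftrightarrow> y \<noteq> gate x i"
proof -
  have g: "gate x i \<in> verts (B i) \<and> (\<forall>y\<in>verts (B i). d x y = d x (gate x i) + d (gate x i) y \<and>
      (is_last x (in_arc i y) \<longleftrightarrow> y \<noteq> gate x i))"
    unfolding gate_def by (rule someI_ex[OF ex_gate[OF assms, of x, unfolded Bex_def]])
  show "gate x i \<in> verts (B i)" using g by (rule conjunct1)
  show "d x y = d x (gate x i) + d (gate x i) y" if "y \<in> verts (B i)"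
    using bspec[OF conjunct2[OF g] that] by (rule conjunct1)
  show "is_last x (in_arc i y) \<longleftrightarrow> y \<noteq> gate x i" if "y \<in> verts (B i)"
    using bspec[OF conjunct2[OF g] that] by (rule conjunct2)
qed

section \<open>Weighted sums over one cycle\<close>

lemma sum_block:
  assumes "i \<in> {1..r}"
  shows "(\<Sum>y\<in>verts (B i). f y) = (\<Sum>k<n i. f (v i k))"
  using labelled[OF assms] by (simp add: sum.reindex)

lemma cycle_beta_vertex:
  "i \<in> {1..r} \<Longrightarrow> k < n i \<Longrightarrow> cycle_beta (n i) (v i) (w i) (v i k) = w i k * ring_inv (fw i)"
  using pos_vertex by (simp add: cycle_beta_def pos_def)

lemma sum_cycle_beta:
  assumes i: "i \<in> {1..r}"
  shows "(\<Sum>y\<in>verts (B i). cycle_beta (n i) (v i) (w i) y) = 1"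
proof -
  have "(\<Sum>y\<in>verts (B i). cycle_beta (n i) (v i) (w i) y) = (\<Sum>k<n i. w i k * ring_inv (fw i))"
    unfolding sum_block[OF i] by (intro sum.cong) (auto simp: cycle_beta_vertex[OF i])
  also have "\<dots> = fw i * ring_inv (fw i)" by (simp add: first_weight_def sum_distrib_right)
  finally show ?thesis using fw_inv[OF i] by (simp add: mult.commute)
qed

text \<open>Restart the labelling at \<open>g\<close>. The vertex \<open>l\<close> steps on lies at
  distance the sum of the first \<open>l\<close> weights, and \<open>cycle_beta\<close> multiplies
  this by the next weight over \<open>fw i\<close>, so each pair of arcs appears once, as in the
  second weight.\<close>

lemma sum_path_weight_cycle_beta:
  assumes i: "i \<in> {1..r}" and g: "g \<in> verts (B i)"
  shows "(\<Sum>y\<in>verts (B i). d g y * cycle_beta (n i) (v i) (w i) y) = cycle_lambda (n i) (w i)"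
proof -
  obtain j where j: "j < n i" "g = v i j" using g labelled[OF i] by auto
  let ?F = "\<lambda>k. d g (v i k) * (w i k * ring_inv (fw i))"
  let ?s = "\<lambda>t. w i ((j + t) mod n i)"
  have "(\<Sum>y\<in>verts (B i). d g y * cycle_beta (n i) (v i) (w i) y) = (\<Sum>k<n i. ?F k)"
    unfolding sum_block[OF i] by (intro sum.cong) (auto simp: cycle_beta_vertex[OF i])
  also have "\<dots> = (\<Sum>l<n i. ?F ((j + l) mod n i))" by (rule sum_cyclic_shift[symmetric])
  also have "\<dots> = (\<Sum>l<n i. (\<Sum>t<l. ?s t) * (?s l * ring_inv (fw i)))"
    using path_weight_cycle[OF i j(1)] j(2) by (intro sum.cong) auto
  also have "\<dots> = second_weight (n i) ?s * ring_inv (fw i)"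
    by (simp add: second_weight_def sum_distrib_right mult.assoc)
  finally show ?thesis
    using second_weight_cyclic_shift[of "n i" "w i" j] by (simp add: cycle_lambda_def)
qed

text \<open>For \<open>y \<noteq> x\<close> exactly one block at \<open>y\<close> contains the last
  arc of the path from \<open>x\<close>, so \<open>y\<close> is the gate of all others at
  \<open>y\<close>. The correction in \<open>glue_vec\<close> thus becomes a sum over gates. After
  exchanging the sums, a block with gate \<open>g\<close> contributes \<open>d x g\<close> plus its
  \<open>cycle_lambda\<close>, minus \<open>d x g\<close>.\<close>

lemma W_beta: "W *v \<beta> = (\<Sum>i = 1..r. cycle_lambda (n i) (w i)) *s all_ones"
proof -
  have "(\<Sum>y\<in>UNIV. d x y * \<beta> $ y) = (\<Sum>i = 1..r. cycle_lambda (n i) (w i))" for x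
  proof -
    let ?b = "\<lambda>i. cycle_beta (n i) (v i) (w i)"
    let ?g = "gate x"
    have summand: "d x y * \<beta> $ y =
        (\<Sum>i\<in>Bl r B y. d x y * ?b i y) - (\<Sum>i\<in>Bl r B y. d x y * of_bool (y = ?g i))" for y
    proof -
      have "of_nat (bi r B y) = (\<Sum>i\<in>Bl r B y. 1 :: 'a)"
        by (simp add: bi_def)
      also have "\<dots> = (\<Sum>i\<in>Bl r B y. of_bool (y = ?g i) + of_bool (y \<noteq> ?g i) :: 'a)"
        by (intro sum.cong) auto
      also have "\<dots> = (\<Sum>i\<in>Bl r B y. of_bool (y = ?g i)) + (\<Sum>i\<in>Bl r B y. of_bool (is_last x (in_arc i y)))"
        unfolding sum.distrib by (intro arg_cong2[of _ _ _ _ "(+)"] sum.cong) (auto simp: gate(3) Bl_def)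
      finally have "of_nat (bi r B y) - 1 = (\<Sum>i\<in>Bl r B y. of_bool (y = ?g i)) - (of_bool (x = y) :: 'a)"
        unfolding sum_is_last by simp
      then have "\<beta> $ y = (\<Sum>i\<in>Bl r B y. ?b i y) - (\<Sum>i\<in>Bl r B y. of_bool (y = ?g i)) + of_bool (x = y)"
        by (simp add: glue_vec_def algebra_simps)
      \<comment> \<open>At \<open>y = x\<close> every block has gate \<open>x\<close>, so the count
        is off by one; the factor \<open>d x x = 0\<close> removes the difference.\<close>
      moreover have "d x y * of_bool (x = y) = 0"
        using path_weight_self[of x wt] verts_UNIV by (cases "x = y") auto
      ultimately show ?thesis
        by (simp only: distrib_left right_diff_distrib sum_distrib_left add_0_right)
    qed
    have "(\<Sum>y\<in>UNIV. d x y * \<beta> $ y) =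
        (\<Sum>i = 1..r. (\<Sum>y\<in>verts (B i). d x y * ?b i y) - (\<Sum>y\<in>verts (B i). d x y * of_bool (y = ?g i)))"
      by (simp only: summand sum_subtractf sum_Bl_swap)
    also have "\<dots> = (\<Sum>i = 1..r. cycle_lambda (n i) (w i))"
    proof (intro sum.cong refl)
      fix i assume i: "i \<in> {1..r}"
      \<comment> \<open>Distances from \<open>x\<close> into the block split at the gate, and the
        entries of \<open>cycle_beta\<close> sum to \<open>1\<close>.\<close>
      have "(\<Sum>y\<in>verts (B i). d x y * ?b i y) =
          (\<Sum>y\<in>verts (B i). d x (?g i) * ?b i y + d (?g i) y * ?b i y)"
        by (intro sum.cong refl) (simp only: distrib_right[symmetric] gate(2)[OF i, symmetric])
      also have "\<dots> = d x (?g i) + cycle_lambda (n i) (w i)"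
        using sum_cycle_beta[OF i] sum_path_weight_cycle_beta[OF i gate(1)[OF i]]
        by (simp add: sum.distrib flip: sum_distrib_left)
      finally have 1: "(\<Sum>y\<in>verts (B i). d x y * ?b i y) = d x (?g i) + cycle_lambda (n i) (w i)" .
      have "(\<Sum>y\<in>verts (B i). d x y * of_bool (y = ?g i)) = (\<Sum>y\<in>verts (B i). if y = ?g i then d x y else 0)"
        by (intro sum.cong) auto
      then have "(\<Sum>y\<in>verts (B i). d x y * of_bool (y = ?g i)) = d x (?g i)" using gate(1)[OF i] by simp
      then show "(\<Sum>y\<in>verts (B i). d x y * ?b i y) - (\<Sum>y\<in>verts (B i). d x y * of_bool (y = ?g i))
          = cycle_lambda (n i) (w i)" using 1 by simp
    qed
    finally show ?thesis .
  qed
  then show ?thesis by (simp add: vec_eq_iff matrix_vector_mult_def W_nth all_ones_def)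
qed

end

theorem theorem4p3:
  fixes G :: "('v::finite, 'e) pre_digraph"
    and wt :: "'e \<Rightarrow> 'a::comm_ring_1"
    and r :: nat
    and B :: "nat \<Rightarrow> ('v, 'e) pre_digraph"
    and n :: "nat \<Rightarrow> nat"
    and v :: "nat \<Rightarrow> nat \<Rightarrow> 'v"
    and e :: "nat \<Rightarrow> nat \<Rightarrow> 'e"
    and w :: "nat \<Rightarrow> nat \<Rightarrow> 'a"
    and lam :: 'a
    and \<alpha> \<beta> :: "'a^'v"
    and L W :: "'a^'v^'v"
  assumes "cactoid_digraph G"
    and "verts G = UNIV"
    and "bij_betw B {1..r} (blocks G)"
    and "\<And>i. i \<in> {1..r} \<Longrightarrow> cycle_labelling (B i) (n i) (v i) (e i)"
    and "\<And>i k. w i k = wt (e i k)"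
    and "\<And>i. i \<in> {1..r} \<Longrightarrow> first_weight (n i) (w i) dvd 1"
    and "W = distance_matrix G wt"
    and "lam = (\<Sum>i = 1..r. cycle_lambda (n i) (w i))"
    and "\<alpha> = glue_vec r B (\<lambda>i. cycle_alpha (n i) (v i) (w i))"
    and "\<beta> = glue_vec r B (\<lambda>i. cycle_beta (n i) (v i) (w i))"
    and "L = glue_mat r B (\<lambda>i. cycle_L (n i) (v i) (w i))"
  shows "scalar_product \<alpha> all_ones = 1 \<and>
         L *v all_ones = 0 \<and>
         \<alpha> v* W = lam *s all_ones \<and>
         L ** W + mat 1 = outer_prod \<beta> all_ones \<and>
         scalar_product all_ones \<beta> = 1 \<and>
         all_ones v* L = 0 \<and>
         W *v \<beta> = lam *s all_ones \<and>
         W ** L + mat 1 = outer_prod all_ones \<alpha> \<and>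
         laplacian_like L \<and>
         (lam dvd 1 \<longrightarrow>
            invertible W \<and> matrix_inv W = - L + outer_prod (ring_inv lam *s \<beta>) \<alpha>)"
proof -
  have w: "w i = (\<lambda>k. wt (e i k))" for i using assms(5) by blast
  interpret digraph G using assms(1) by (simp add: cactoid_digraph_def)
  interpret labelled_cactoid G r B n v e wt
    by unfold_locales (use assms(1-4,6) in \<open>auto simp: cactoid_digraph_def w\<close>)
  note eqs = assms(7-11)[unfolded w]
  \<comment> \<open>From these five equations \<open>bag_identities\<close> derives the
    normalisations, the value of \<open>\<alpha> v* W\<close> and the inverse.\<close>
  have identities: "L *v all_ones = 0" "all_ones v* L = 0" "L ** W + mat 1 = outer_prod \<beta> all_ones"
    "W ** L + mat 1 = outer_prod all_ones \<alpha>" "W *v \<beta> = lam *s all_ones"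
    unfolding eqs by (rule L_all_ones all_ones_L L_W W_L W_beta)+
  show ?thesis
    using identities bag_identities[OF identities] by (simp add: laplacian_like_def)
qed

end
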